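(* Let $a,b,c>0$ and let $T$ be an orthoscheme in the hyperbolic space $\mathbb{H}^3$ of constant curvature $-1$ with consecutive edge lengths $a,b,c$, i.e. $T=\operatorname{conv}(A_0,A_1,A_2,A_3)$ with $|A_0A_1|=a$, $|A_1A_2|=b$, $|A_2A_3|=c$, where the edge $A_0A_1$ is orthogonal to the edge $A_1A_2$ and the edge $A_2A_3$ is orthogonal to the plane spanned by $A_0,A_1,A_2$. Then the hyperbolic volume $v$ of $T$ is $$ v=\frac{1}{4}\int_{0}^{b}\frac{\tanh \lambda \,\sinh a}{\sqrt{\tanh^2 b\,\cosh^2\lambda+\sinh^2 a\,\sinh^2\lambda}}\;\ln\left(\frac{\sinh b+\tanh c\,\sinh\lambda}{\sinh b-\tanh c\,\sinh\lambda}\right)\mathrm{d}\lambda . $$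
   Context: $\mathbb{H}^n$ is $n$-dimensional hyperbolic space, with its standard Riemannian volume (curvature normalised to $-1$; the paper's curvature parameter $k$ equals $1$). An orthoscheme in $\mathbb{H}^3$ is a tetrahedron $A_0A_1A_2A_3$ in which the edges $A_0A_1$ and $A_1A_2$ are orthogonal to each other and the edge $A_2A_3$ is orthogonal to the plane of $A_0,A_1,A_2$. *)

theory Defs
  imports "HOL-Analysis.Analysis"
begin

text \<open>
  The Beltrami--Klein (projective) model of hyperbolic space of constant curvature \<open>-1\<close>: the
  points are those of the open unit ball and the geodesics are the Euclidean chords.  Hence
  the hyperbolic segment between two points is their \<^const>\<open>closed_segment\<close>, the hyperbolic
  convex hull of a subset is its \<^const>\<open>hull\<close> with respect to \<^const>\<open>convex\<close>, and the hyperbolic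
  subspace spanned by a subset is its affine hull intersected with the ball.
\<close>

definition hyp_space :: "(real ^ 'n) set" where
  "hyp_space = ball 0 1"

text \<open>
  The metric tensor at \<open>x\<close>.  It is the pull-back of the Lorentzian form under the map
  \<open>x \<mapsto> (x, 1) / sqrt (1 - norm x ^ 2)\<close> from the ball onto the upper sheet of the hyperboloid.
\<close>

definition hyp_metric :: "real ^ 'n \<Rightarrow> real ^ 'n \<Rightarrow> real ^ 'n \<Rightarrow> real" where
  "hyp_metric x u v =
     (u \<bullet> v) / (1 - (norm x)\<^sup>2) + (x \<bullet> u) * (x \<bullet> v) / (1 - (norm x)\<^sup>2)\<^sup>2"

definition hyp_dist :: "real ^ 'n \<Rightarrow> real ^ 'n \<Rightarrow> real" where
  "hyp_dist x y = arcosh ((1 - x \<bullet> y) / (sqrt (1 - (norm x)\<^sup>2) * sqrt (1 - (norm y)\<^sup>2)))"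

text \<open>The Riemannian volume of the metric tensor, with density \<open>sqrt (det g)\<close>.\<close>

definition hyp_volume :: "(real ^ 'n) measure" where
  "hyp_volume = density lborel
     (\<lambda>x. indicator hyp_space x *
          ennreal (sqrt (det (\<chi> i j. hyp_metric x (axis i 1) (axis j 1)))))"

text \<open>
  The geodesic from \<open>P\<close> to \<open>X\<close> leaves \<open>P\<close> in the direction of the tangent vector \<open>X - P\<close>.
  The model is not conformal, so this differs from Euclidean orthogonality.
\<close>

definition hyp_orthogonal_at :: "real ^ 'n \<Rightarrow> real ^ 'n \<Rightarrow> real ^ 'n \<Rightarrow> bool" where
  "hyp_orthogonal_at P X Y \<longleftrightarrow> hyp_metric P (X - P) (Y - P) = 0"

definition hyp_span :: "(real ^ 'n) set \<Rightarrow> (real ^ 'n) set" where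
  "hyp_span S = affine hull S \<inter> hyp_space"

text \<open>Vertices \<open>A0, A1, A2, A3\<close> of an orthoscheme with consecutive edge lengths \<open>a, b, c\<close>.\<close>

definition is_orthoscheme ::
    "real ^ 3 \<Rightarrow> real ^ 3 \<Rightarrow> real ^ 3 \<Rightarrow> real ^ 3 \<Rightarrow> real \<Rightarrow> real \<Rightarrow> real \<Rightarrow> bool" where
  "is_orthoscheme A0 A1 A2 A3 a b c \<longleftrightarrow>
     {A0, A1, A2, A3} \<subseteq> hyp_space \<and>
     hyp_dist A0 A1 = a \<and> hyp_dist A1 A2 = b \<and> hyp_dist A2 A3 = c \<and>
     hyp_orthogonal_at A1 A0 A2 \<and>
     (\<forall>P \<in> hyp_span {A0, A1, A2}. hyp_orthogonal_at A2 P A3)"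

text \<open>
  Consistency of \<^const>\<open>hyp_dist\<close> with \<^const>\<open>hyp_metric\<close>: the distance of two points is the
  Riemannian length of the chord between them.
\<close>

lemma hyp_dist_eq_length:
  fixes x y :: "real ^ 'n"
  assumes x: "x \<in> hyp_space" and y: "y \<in> hyp_space"
  shows "((\<lambda>t. sqrt (hyp_metric (x + t *\<^sub>R (y - x)) (y - x) (y - x)))
           has_integral hyp_dist x y) {0..1}"
proof -
  define w where "w = y - x"
  define s where "s = x \<bullet> w"
  define W where "W = w \<bullet> w"
  define M where "M = 1 - x \<bullet> x"
  define N where "N = (\<lambda>t. M - 2 * t * s - t\<^sup>2 * W)"
  define K where "K = sqrt (s\<^sup>2 + M * W)"
  have nx: "norm x < 1" and ny: "norm y < 1"
    using x y by (auto simp: hyp_space_def)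
  have M: "M > 0"
    using nx by (simp add: M_def flip: power2_norm_eq_inner) (simp add: power_less_one_iff)
  have W: "W \<ge> 0" by (simp add: W_def)
  have K: "K \<ge> 0" and K2: "K\<^sup>2 = s\<^sup>2 + M * W"
    using M W by (simp_all add: K_def)
  have N_eq: "1 - (norm (x + t *\<^sub>R w))\<^sup>2 = N t" for t
    unfolding power2_norm_eq_inner
    by (simp add: N_def M_def s_def W_def inner_simps inner_commute power2_eq_square algebra_simps)
  have N: "N t > 0" if "t \<in> {0..1}" for t
  proof -
    have "x + t *\<^sub>R w \<in> closed_segment x y"
      using that by (auto simp: closed_segment_def w_def algebra_simps intro!: exI[of _ t])
    also have "closed_segment x y \<subseteq> hyp_space"
      unfolding hyp_space_def using x y
      by (intro closed_segment_subset) (auto simp: hyp_space_def)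
    finally have "norm (x + t *\<^sub>R w) < 1" by (simp add: hyp_space_def)
    then have "(norm (x + t *\<^sub>R w))\<^sup>2 < 1" by (simp add: power_less_one_iff)
    then show ?thesis using N_eq[of t] by linarith
  qed
  have tensor: "sqrt (hyp_metric (x + t *\<^sub>R w) w w) = K / N t" if "t \<in> {0..1}" for t
  proof -
    have "hyp_metric (x + t *\<^sub>R w) w w = W / N t + (s + t * W)\<^sup>2 / (N t)\<^sup>2"
      unfolding hyp_metric_def N_eq
      by (simp add: inner_add_left power2_eq_square flip: s_def W_def)
    also have "\<dots> = (W * N t + (s + t * W)\<^sup>2) / (N t)\<^sup>2"
      using N[OF that] by (simp add: field_simps power2_eq_square)
    also have "W * N t + (s + t * W)\<^sup>2 = K\<^sup>2"
      unfolding K2 by (simp add: N_def power2_eq_square algebra_simps)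
    finally show ?thesis
      using K N[OF that] by (simp add: real_sqrt_divide)
  qed
  have key: "(M - t * s)\<^sup>2 - (t * K)\<^sup>2 = M * N t" for t
    by (simp add: power_mult_distrib K2 N_def) (simp add: power2_eq_square algebra_simps)
  have pos: "M - t * s > 0" if "t \<in> {0..1}" for t
  proof -
    have "x \<bullet> y < 1"
    proof -
      have "x \<bullet> y \<le> norm x * norm y" by (rule norm_cauchy_schwarz)
      also have "\<dots> \<le> norm x" using ny by (simp add: mult_left_le)
      finally show ?thesis using nx by linarith
    qed
    then have "M - s > 0" by (simp add: M_def s_def w_def inner_simps)
    then have "0 < (1 - t) * M + t * (M - s)"
      using that M by (cases "t = 0") (auto intro!: add_nonneg_pos)
    then show ?thesis by (simp add: algebra_simps)
  qed
  have lt: "t * K < M - t * s" if "t \<in> {0..1}" for t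
  proof -
    have "(t * K)\<^sup>2 < (M - t * s)\<^sup>2"
      using key[of t] N[OF that] M by (smt (verit) mult_pos_pos)
    then show ?thesis using pos[OF that] by (meson less_imp_le power2_less_imp_less)
  qed
  define F where "F = (\<lambda>t. artanh (t * K / (M - t * s)))"
  have deriv: "(F has_real_derivative K / N t) (at t)" if t: "t \<in> {0..1}" for t
  proof -
    let ?D = "M - t * s"
    have D: "?D > 0" by (rule pos[OF t])
    have small: "\<bar>t * K / ?D\<bar> < 1"
      using lt[OF t] D K t by (simp add: abs_mult)
    have "((\<lambda>t. t * K / (M - t * s)) has_real_derivative K * M / ?D\<^sup>2) (at t)"
      using D by (auto intro!: derivative_eq_intros simp: field_simps power2_eq_square)
    from DERIV_chain2[OF artanh_real_has_field_derivative[OF small] this]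
    have "(F has_real_derivative 1 / (1 - (t * K / ?D)\<^sup>2) * (K * M / ?D\<^sup>2)) (at t)"
      unfolding F_def by simp
    moreover have "1 - (t * K / ?D)\<^sup>2 = M * N t / ?D\<^sup>2"
      using D by (simp add: key[symmetric] power_divide diff_divide_distrib)
    ultimately show ?thesis using D M N[OF t] by simp
  qed
  have "((\<lambda>t. K / N t) has_integral F 1 - F 0) {0..1}"
    by (intro fundamental_theorem_of_calculus)
      (auto intro: DERIV_subset[OF deriv] simp flip: has_real_derivative_iff_has_vector_derivative)
  moreover have "F 0 = 0" by (simp add: F_def)
  moreover have "F 1 = hyp_dist x y"
  proof -
    define D where "D = M - s"
    have D: "D > 0" and KD: "K < D" using pos[of 1] lt[of 1] by (auto simp: D_def)
    have D': "D = 1 - x \<bullet> y" by (simp add: D_def M_def s_def w_def inner_simps)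
    have N1: "N 1 > 0" using N[of 1] by simp
    have *: "D\<^sup>2 - K\<^sup>2 = M * N 1" using key[of 1] by (simp add: D_def)
    have NM: "1 - (norm x)\<^sup>2 = M" "1 - (norm y)\<^sup>2 = N 1"
      using N_eq[of 1] by (simp_all add: M_def power2_norm_eq_inner w_def)
    define S where "S = sqrt (M * N 1)"
    have S: "S > 0" "S\<^sup>2 = M * N 1" using M N1 by (simp_all add: S_def)
    have hd: "hyp_dist x y = arcosh (D / S)"
      by (simp add: hyp_dist_def NM D' S_def real_sqrt_mult)
    have "S\<^sup>2 \<le> D\<^sup>2" using * S(2) zero_le_power2[of K] by linarith
    then have SD: "S \<le> D" using D by (meson less_imp_le power2_le_imp_le)
    have "(D / S)\<^sup>2 - 1 = (K / S)\<^sup>2"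
      using M N1 * S(2) by (simp add: power_divide field_simps)
    then have "arcosh (D / S) = ln (D / S + sqrt ((K / S)\<^sup>2))"
      using SD S(1) by (subst arcosh_real_def) simp_all
    also have "\<dots> = ln ((D + K) / S)"
      using K S(1) by (simp add: add_divide_distrib)
    also have "\<dots> = ln (sqrt ((D + K) / (D - K)))"
    proof -
      have "S\<^sup>2 = (D + K) * (D - K)" using * S(2) by (simp add: power2_eq_square algebra_simps)
      then have "((D + K) / S)\<^sup>2 = (D + K) / (D - K)"
        using KD D K by (simp add: power_divide power2_eq_square)
      then have "sqrt ((D + K) / (D - K)) = (D + K) / S"
        using D K S(1) by (intro real_sqrt_unique) simp_all
      then show ?thesis by simp
    qed
    also have "\<dots> = ln ((D + K) / (D - K)) / 2"
      using D K KD by (subst ln_sqrt) simp_all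
    also have "(D + K) / (D - K) = (1 + K / D) / (1 - K / D)"
      using D KD by (simp add: field_simps)
    finally show ?thesis by (simp add: hd F_def artanh_def flip: D_def)
  qed
  ultimately have "((\<lambda>t. K / N t) has_integral hyp_dist x y) {0..1}" by simp
  then show ?thesis
    by (rule has_integral_eq[rotated]) (simp add: tensor flip: w_def)
qed

end

theory Submission
  imports Defs
begin

text \<open>
  A boost followed by an orthogonal map moves the orthoscheme to the one with
  \<open>A1 = 0\<close> and its edges parallel to the coordinate axes.  For a point of its base, let \<open>s\<close> be
  the coordinate along \<open>A0A1\<close> and \<open>\<lambda>\<close> the distance from \<open>A0A1\<close>.  The fiber above the point has length
  \<open>h(\<lambda>)\<close> with \<open>tanh h = tanh c * sinh \<lambda> / sinh b\<close>, so the volume is the integral of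
  \<open>1/2 * (h + sinh h * cosh h) * cosh \<lambda>\<close> over the base.  This integrand is the \<open>\<lambda>\<close>-derivative of
  \<open>1/2 * h * sinh \<lambda>\<close>, hence the volume is the integral of \<open>1/2 * h(\<lambda>) * sinh \<lambda>\<close> with respect to \<open>s\<close> along the
  hypotenuse \<open>A0A2\<close>, where \<open>sinh (a - s) = sinh a * tanh \<lambda> / tanh b\<close>; changing the variable from \<open>s\<close> to
  \<open>\<lambda>\<close> gives the formula.
\<close>

subsection \<open>The volume in the Klein model\<close>

lemma one_minus_tanh_square: "1 - (tanh t)\<^sup>2 = 1 / (cosh t)\<^sup>2" for t :: real
  by (simp add: tanh_def power_divide sinh_square_eq diff_divide_distrib)

text \<open>The Riemannian density of the Klein model in dimension \<open>n\<close> is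
  \<open>1 - norm x ^ 2\<close> to the power \<open>-(n + 1) / 2\<close>; here
  \<open>n = 3\<close>.\<close>

definition klein_density :: "real ^ 3 \<Rightarrow> real" where
  "klein_density x = 1 / (1 - (norm x)\<^sup>2)\<^sup>2"

text \<open>The metric matrix is the rank-one perturbation \<open>I / m + x x^T / m^2\<close>, so
  its determinant is \<open>(1 + norm x ^ 2 / m) / m ^ 3\<close>, which collapses to
  \<open>1 / m ^ 4\<close> because \<open>norm x ^ 2 = 1 - m\<close>.\<close>

lemma det_hyp_metric:
  fixes x :: "real ^ 3"
  assumes "norm x < 1"
  shows "sqrt (det (\<chi> i j. hyp_metric x (axis i 1) (axis j 1))) = klein_density x"
proof -
  define m where "m = 1 - (norm x)\<^sup>2"
  have m: "m > 0" using assms by (simp add: m_def power_less_one_iff)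
  have nx: "(x$1)\<^sup>2 + (x$2)\<^sup>2 + (x$3)\<^sup>2 = 1 - m"
    by (simp add: m_def norm_vec_def L2_set_def sum_3)
  have entry: "hyp_metric x (axis i 1) (axis j 1) =
      (if i = j then 1 else 0) / m + x$i * x$j / m\<^sup>2" for i j
    by (simp add: hyp_metric_def inner_axis_axis inner_axis flip: m_def) (simp add: axis_def)
  have "det (\<chi> i j. hyp_metric x (axis i 1) (axis j 1)) =
      1 / m ^ 3 + ((x$1)\<^sup>2 + (x$2)\<^sup>2 + (x$3)\<^sup>2) / m ^ 4"
    using m unfolding det_3 entry by simp
      (simp add: field_simps eval_nat_numeral)
  also have "\<dots> = (1 / m\<^sup>2)\<^sup>2"
    unfolding nx using m by (simp add: field_simps eval_nat_numeral)
  finally show ?thesis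
    using m by (simp add: klein_density_def flip: m_def)
qed

lemma emeasure_hyp_volume:
  assumes "compact T" "T \<subseteq> hyp_space"
  shows "emeasure hyp_volume T = (\<integral>\<^sup>+x. ennreal (klein_density x) * indicator T x \<partial>lborel)"
proof -
  let ?w = "\<lambda>x::real^3. indicator hyp_space x *
    ennreal (sqrt (det (\<chi> i j. hyp_metric x (axis i 1) (axis j 1))))"
  have "?w = (\<lambda>x. indicator (ball 0 1) x * ennreal (klein_density x))"
    by (auto simp: fun_eq_iff indicator_def hyp_space_def det_hyp_metric)
  moreover have "klein_density \<in> borel_measurable borel"
    unfolding klein_density_def [abs_def] by measurable
  moreover have "(indicator (ball 0 1) :: real ^ 3 \<Rightarrow> ennreal) \<in> borel_measurable borel"
    by (intro borel_measurable_indicator) simp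
  ultimately have "?w \<in> borel_measurable lborel" by simp
  then have "emeasure hyp_volume T = (\<integral>\<^sup>+x. ?w x * indicator T x \<partial>lborel)"
    using assms(1) by (simp add: hyp_volume_def emeasure_density compact_imp_closed)
  also have "\<dots> = (\<integral>\<^sup>+x. ennreal (klein_density x) * indicator T x \<partial>lborel)"
    using assms(2)
    by (intro nn_integral_cong) (auto simp: indicator_def hyp_space_def det_hyp_metric)
  finally show ?thesis .
qed

lemma klein_density_absolutely_integrable:
  assumes "compact T" "T \<subseteq> hyp_space"
  shows "klein_density absolutely_integrable_on T"
proof -
  have "continuous_on T klein_density"
    unfolding klein_density_def [abs_def]
  proof (intro continuous_intros ballI)
    fix x assume "x \<in> T"
    then have "norm x < 1" using assms(2) by (auto simp: hyp_space_def)
    then have "(norm x)\<^sup>2 < 1" by (simp add: power_less_one_iff)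
    then show "(1 - (norm x)\<^sup>2)\<^sup>2 \<noteq> 0" by simp
  qed
  from borel_integrable_compact[OF assms(1) this]
  show ?thesis
    by (simp add: set_integrable_def integrable_completion)
qed

text \<open>Passes from the measure to the Henstock-Kurzweil integral, in whose terms the change of
  variables is carried out.\<close>

lemma measure_hyp_volume:
  assumes "compact T" "T \<subseteq> hyp_space"
  shows "measure hyp_volume T = integral T klein_density"
proof -
  have "klein_density integrable_on T"
    using klein_density_absolutely_integrable[OF assms]
    by (rule set_lebesgue_integral_eq_integral)
  then have I: "(klein_density has_integral integral T klein_density) T"
    by (rule integrable_integral)
  have nn: "klein_density x \<ge> 0" for x by (simp add: klein_density_def)
  have "emeasure hyp_volume T = ennreal (integral T klein_density)"
    unfolding emeasure_hyp_volume[OF assms]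
    by (rule nn_integral_has_integral_lebesgue'[OF nn I])
  then show ?thesis
    using has_integral_nonneg[OF I nn] by (simp add: measure_def)
qed

lemma measurable_vector3:
  "(\<lambda>(x, y, z). vector [x, y, z] :: real ^ 3) \<in> lborel \<Otimes>\<^sub>M lborel \<Otimes>\<^sub>M lborel \<rightarrow>\<^sub>M borel"
proof -
  have "(\<lambda>(x, y, z). vector [x, y, z] :: real ^ 3) =
      (\<lambda>(x, y, z). x *\<^sub>R axis 1 1 + y *\<^sub>R axis 2 1 + z *\<^sub>R axis 3 1)"
    by (auto simp: fun_eq_iff vec_eq_iff forall_3 axis_def)
  also have "\<dots> \<in> borel \<rightarrow>\<^sub>M borel"
    by (intro borel_measurable_continuous_onI) (auto simp: case_prod_beta intro!: continuous_intros)
  finally show ?thesis by (simp add: lborel_prod)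
qed

subsection \<open>Isometries\<close>

text \<open>
  A Lorentz transformation maps \<open>(x, 1)\<close> to \<open>e x *\<^sub>R (g x, 1)\<close>; both components are affine in \<open>x\<close>.
\<close>

locale hyp_isometry =
  fixes g :: "real ^ 3 \<Rightarrow> real ^ 3" and e :: "real ^ 3 \<Rightarrow> real"
    and g' :: "real ^ 3 \<Rightarrow> real ^ 3 \<Rightarrow> real ^ 3"
  assumes e_pos: "norm x < 1 \<Longrightarrow> e x > 0"
    and e_affine: "e ((1 - u) *\<^sub>R x + u *\<^sub>R y) = (1 - u) * e x + u * e y"
    and g_affine: "\<lbrakk>norm x < 1; norm y < 1; norm ((1 - u) *\<^sub>R x + u *\<^sub>R y) < 1\<rbrakk> \<Longrightarrow>
      e ((1 - u) *\<^sub>R x + u *\<^sub>R y) *\<^sub>R g ((1 - u) *\<^sub>R x + u *\<^sub>R y) =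
      ((1 - u) * e x) *\<^sub>R g x + (u * e y) *\<^sub>R g y"
    and lorentz: "\<lbrakk>norm x < 1; norm y < 1\<rbrakk> \<Longrightarrow> (1 - g x \<bullet> g y) * (e x * e y) = 1 - x \<bullet> y"
    and deriv: "norm x < 1 \<Longrightarrow> (g has_derivative g' x) (at x)"
    and jacobian: "norm x < 1 \<Longrightarrow> \<bar>det (matrix (g' x))\<bar> * e x ^ 4 = 1"
begin

lemma lorentz_eq: "\<lbrakk>norm x < 1; norm y < 1\<rbrakk> \<Longrightarrow> 1 - g x \<bullet> g y = (1 - x \<bullet> y) / (e x * e y)"
  using lorentz[of x y] e_pos[of x] e_pos[of y] by (simp add: field_simps)

lemma lorentz_norm: "norm x < 1 \<Longrightarrow> 1 - (norm (g x))\<^sup>2 = (1 - (norm x)\<^sup>2) / (e x)\<^sup>2"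
  using lorentz_eq[of x x] unfolding power2_norm_eq_inner by (simp add: power2_eq_square)

lemma norm_image: 
  assumes "norm x < 1"
  shows "norm (g x) < 1"
proof -
  have "(norm x)\<^sup>2 < 1" using assms by (simp add: power_less_one_iff)
  then have "(norm (g x))\<^sup>2 < 1"
    using lorentz_norm[OF assms] e_pos[OF assms]
    by (smt (verit) divide_pos_pos zero_less_power)
  then show ?thesis by (simp add: power_less_one_iff)
qed

lemma hyp_dist_image:
  assumes "norm x < 1" "norm y < 1"
  shows "hyp_dist (g x) (g y) = hyp_dist x y"
  using e_pos[OF assms(1)] e_pos[OF assms(2)]
  by (simp add: hyp_dist_def lorentz_norm lorentz_eq assms real_sqrt_divide)

text \<open>Equal images give, by \<open>lorentz\<close>, equality in the reversed Cauchy-Schwarz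
  inequality for the time-like vectors \<open>(x, 1)\<close> and \<open>(y, 1)\<close>; written with
  \<open>w = y - x\<close>, this forces \<open>w = 0\<close>.\<close>

lemma inj_on_image: "inj_on g (ball 0 1)"
proof (rule inj_onI)
  fix x y assume xy: "x \<in> ball (0 :: real ^ 3) 1" "y \<in> ball (0 :: real ^ 3) 1" and eq: "g x = g y"
  have nx: "norm x < 1" and ny: "norm y < 1" using xy by auto
  define w where "w = y - x"
  have "(1 - x \<bullet> y)\<^sup>2 = (1 - (norm x)\<^sup>2) * (1 - (norm y)\<^sup>2)"
    using lorentz[OF nx ny] lorentz[OF nx nx] lorentz[OF ny ny] unfolding power2_norm_eq_inner
    by (metis eq power2_eq_square mult.assoc mult.left_commute)
  then have "w \<bullet> w * (1 - x \<bullet> x) = - (x \<bullet> w)\<^sup>2"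
    unfolding power2_norm_eq_inner w_def
    by (simp add: inner_simps inner_commute power2_eq_square algebra_simps)
  then have "w \<bullet> w * (1 - x \<bullet> x) \<le> 0" by simp
  moreover have "x \<bullet> x < 1" using nx by (simp add: power_less_one_iff flip: power2_norm_eq_inner)
  ultimately have "w \<bullet> w \<le> 0" by (simp add: mult_le_0_iff)
  then have "w \<bullet> w = 0" by (metis inner_ge_zero order_antisym)
  then show "x = y" by (simp add: w_def)
qed

text \<open>Since \<open>e\<close> and \<open>e x *\<^sub>R g x\<close> are affine, the weight
  \<open>u\<close> becomes \<open>u * e y / e z\<close>, which stays in \<open>[0, 1]\<close>
  because \<open>e\<close> is positive.\<close>

lemma segment_image:
  assumes nx: "norm x < 1" and ny: "norm y < 1" and z: "z \<in> closed_segment x y"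
  shows "g z \<in> closed_segment (g x) (g y)"
proof -
  from z obtain u where u: "0 \<le> u" "u \<le> 1" and zu: "z = (1 - u) *\<^sub>R x + u *\<^sub>R y"
    by (auto simp: closed_segment_def)
  have nz: "norm z < 1"
    using closed_segment_subset[OF _ _ convex_ball, of x 0 1 y] nx ny z by auto
  define v where "v = u * e y / e z"
  have ez: "e z = (1 - u) * e x + u * e y" unfolding zu by (rule e_affine)
  have v1: "1 - v = (1 - u) * e x / e z"
    using e_pos[OF nz] by (simp add: v_def field_simps ez)
  have v0: "v \<ge> 0" "1 - v \<ge> 0"
    unfolding v1 unfolding v_def using e_pos[OF nz] e_pos[OF nx] e_pos[OF ny] u by simp_all
  have "e z *\<^sub>R g z = ((1 - u) * e x) *\<^sub>R g x + (u * e y) *\<^sub>R g y"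
    using g_affine[OF nx ny] nz unfolding zu by blast
  then have "(1 / e z) *\<^sub>R (e z *\<^sub>R g z) = (1 - v) *\<^sub>R g x + v *\<^sub>R g y"
    unfolding v1 by (simp add: v_def scaleR_add_right)
  then have "g z = (1 - v) *\<^sub>R g x + v *\<^sub>R g y"
    using e_pos[OF nz] by simp
  then show ?thesis using v0 by (auto simp: closed_segment_def)
qed

text \<open>Solving \<open>v = u * e y / e z\<close> for \<open>u\<close> gives the weight
  \<open>v * e x / D\<close> of a preimage on the segment.\<close>

lemma segment_image':
  assumes nx: "norm x < 1" and ny: "norm y < 1" and q: "q \<in> closed_segment (g x) (g y)"
  shows "q \<in> g ` closed_segment x y"
proof -
  from q obtain v where v: "0 \<le> v" "v \<le> 1" and qv: "q = (1 - v) *\<^sub>R g x + v *\<^sub>R g y"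
    by (auto simp: closed_segment_def)
  note ex = e_pos[OF nx] and ey = e_pos[OF ny]
  define D where "D = v * e x + (1 - v) * e y"
  have D: "D > 0"
    using v ex ey unfolding D_def
    by (cases "v = 0") (auto intro!: add_pos_nonneg)
  define u where "u = v * e x / D"
  have u1: "1 - u = (1 - v) * e y / D"
  proof -
    have "1 - u = (D - v * e x) / D"
      using D by (simp add: u_def diff_divide_distrib)
    then show ?thesis by (simp add: D_def)
  qed
  have u: "0 \<le> u" "0 \<le> 1 - u"
    unfolding u1 unfolding u_def using v ex ey D by simp_all
  define z where "z = (1 - u) *\<^sub>R x + u *\<^sub>R y"
  have zs: "z \<in> closed_segment x y" using u by (auto simp: closed_segment_def z_def)
  then have nz: "norm z < 1"
    using closed_segment_subset[OF _ _ convex_ball, of x 0 1 y] nx ny by auto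
  have ez: "e z = e x * e y / D"
    unfolding z_def e_affine unfolding u1 unfolding u_def using D by (simp add: field_simps)
  have "e z *\<^sub>R g z = ((1 - u) * e x) *\<^sub>R g x + (u * e y) *\<^sub>R g y"
    using g_affine[OF nx ny] nz unfolding z_def by blast
  also have "\<dots> = e z *\<^sub>R q"
  proof -
    have "(1 - u) * e x = e z * (1 - v)" "u * e y = e z * v"
      unfolding u1 ez unfolding u_def by simp_all
    then show ?thesis by (simp add: qv scaleR_add_right)
  qed
  finally have "g z = q" using e_pos[OF nz] by simp
  then show ?thesis using zs by blast
qed

text \<open>Both inclusions use minimality of the hull: the preimage \<open>C\<close> of the right
  side is convex by \<open>segment_image\<close>, and the left side is convex by
  \<open>segment_image'\<close>.\<close>

lemma convex_hull_image:
  assumes S: "S \<subseteq> ball 0 1"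
  shows "g ` (convex hull S) = convex hull (g ` S)"
proof
  have hb: "convex hull S \<subseteq> ball 0 1" using S by (intro hull_minimal) auto
  define C where "C = {x \<in> ball 0 1. g x \<in> convex hull (g ` S)}"
  have "closed_segment x y \<subseteq> C" if "x \<in> C" "y \<in> C" for x y
  proof
    fix z assume z: "z \<in> closed_segment x y"
    from that have x: "x \<in> ball 0 1" "g x \<in> convex hull (g ` S)"
      and y: "y \<in> ball 0 1" "g y \<in> convex hull (g ` S)" by (auto simp: C_def)
    have "z \<in> ball 0 1"
      using closed_segment_subset[OF x(1) y(1) convex_ball] z by blast
    moreover have "g z \<in> closed_segment (g x) (g y)" using segment_image x y z by simp
    moreover have "closed_segment (g x) (g y) \<subseteq> convex hull (g ` S)"
      using x y by (intro closed_segment_subset) auto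
    ultimately show "z \<in> C" unfolding C_def by blast
  qed
  then have "convex C" by (simp add: convex_contains_segment)
  then have "convex hull S \<subseteq> C"
    using S by (intro hull_minimal) (auto simp: C_def intro: hull_inc)
  then show "g ` (convex hull S) \<subseteq> convex hull (g ` S)" unfolding C_def by blast
  have "closed_segment p r \<subseteq> g ` (convex hull S)"
    if "p \<in> g ` (convex hull S)" "r \<in> g ` (convex hull S)" for p r
  proof
    fix q assume q: "q \<in> closed_segment p r"
    from that obtain x y
      where x: "x \<in> convex hull S" "p = g x" and y: "y \<in> convex hull S" "r = g y"
      by blast
    have "norm x < 1" "norm y < 1" using x(1) y(1) hb by auto
    then have "q \<in> g ` closed_segment x y" using q unfolding x(2) y(2) by (rule segment_image')
    also have "\<dots> \<subseteq> g ` (convex hull S)"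
      using x y by (intro image_mono closed_segment_subset) auto
    finally show "q \<in> g ` (convex hull S)" .
  qed
  then have "convex (g ` (convex hull S))" by (subst convex_contains_segment) blast
  then show "convex hull (g ` S) \<subseteq> g ` (convex hull S)"
    by (intro hull_minimal) (auto intro: hull_inc)
qed

text \<open>By \<open>lorentz_norm\<close> the density at \<open>g x\<close> is
  \<open>e x ^ 4\<close> times that at \<open>x\<close>, and \<open>jacobian\<close> cancels exactly
  this factor.\<close>

lemma measure_image:
  assumes T: "compact T" "T \<subseteq> hyp_space"
  shows "measure hyp_volume (g ` T) = measure hyp_volume T"
proof -
  have nT: "norm x < 1" if "x \<in> T" for x using T(2) that by (auto simp: hyp_space_def)
  have cont: "continuous_on T g"
    using nT deriv by (meson continuous_at_imp_continuous_on has_derivative_continuous)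
  have gT: "compact (g ` T)" "g ` T \<subseteq> hyp_space"
    using compact_continuous_image[OF cont T(1)] norm_image nT by (auto simp: hyp_space_def)
  have density: "\<bar>det (matrix (g' x))\<bar> * klein_density (g x) = klein_density x" if "x \<in> T" for x
  proof -
    have "klein_density (g x) = klein_density x * e x ^ 4"
      by (simp add: klein_density_def lorentz_norm[OF nT[OF that]] power_divide flip: power_mult)
    then show ?thesis using jacobian[OF nT[OF that]] by (simp add: mult_ac)
  qed
  \<comment> \<open>The change-of-variables theorem speaks of vector-valued integrands, so the
    density is wrapped in \<open>real ^ 1\<close>.\<close>
  let ?f = "\<lambda>x. vec (klein_density x) :: real ^ 1"
  have "?f absolutely_integrable_on (g ` T) \<and>
      integral (g ` T) ?f = vec (integral (g ` T) klein_density)"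
    using klein_density_absolutely_integrable[OF gT]
    by (simp add: absolutely_integrable_on_1_iff integral_on_1_eq)
  moreover have "T \<in> sets lebesgue"
    using T(1) by (simp add: compact_imp_closed sets_completionI_sets)
  moreover have "inj_on g T"
    using inj_on_image T(2) by (simp add: hyp_space_def inj_on_subset)
  ultimately have "integral T (\<lambda>x. \<bar>det (matrix (g' x))\<bar> *\<^sub>R ?f (g x)) =
      vec (integral (g ` T) klein_density)"
    using has_absolute_integral_change_of_variables[of T g g' ?f] deriv nT
    by (metis (lifting) has_derivative_at_withinI)
  also have "integral T (\<lambda>x. \<bar>det (matrix (g' x))\<bar> *\<^sub>R ?f (g x)) = integral T ?f"
    by (rule integral_cong) (simp add: density vec_eq_iff)
  also have "\<dots> = vec (integral T klein_density)"
    by (simp add: integral_on_1_eq)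
  finally show ?thesis
    by (simp add: measure_hyp_volume T gT vec_eq_iff)
qed

end

section \<open>Orthogonal maps and boosts\<close>

lemma hyp_isometry_orthogonal:
  assumes f: "orthogonal_transformation f"
  shows "hyp_isometry f (\<lambda>_. 1) (\<lambda>_. f)"
proof
  have lin: "linear f" using f by (simp add: orthogonal_transformation_def)
  show "1 *\<^sub>R f ((1 - u) *\<^sub>R x + u *\<^sub>R y) = ((1 - u) * 1) *\<^sub>R f x + (u * 1) *\<^sub>R f y" for u x y
    by (simp add: linear_add[OF lin] linear_scale[OF lin])
  show "(1 - f x \<bullet> f y) * (1 * 1) = 1 - x \<bullet> y" for x y
    using f by (simp add: orthogonal_transformation_def)
  show "(f has_derivative f) (at x)" for x
    using lin by (simp add: linear_imp_has_derivative)
  have "orthogonal_matrix (matrix f)"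
    using f by (simp add: orthogonal_transformation_matrix)
  then show "\<bar>det (matrix f)\<bar> * 1 ^ 4 = 1"
    using det_orthogonal_matrix[of "matrix f"] by auto
qed auto

text \<open>The Lorentz boost of velocity \<open>p\<close> along the first axis, in Klein
  coordinates: the first coordinate becomes \<open>(x$1 - p) / (1 - p * x$1)\<close>, and the other
  two are multiplied by \<open>sqrt (1 - p^2) / (1 - p * x$1)\<close>.\<close>

definition boost :: "real \<Rightarrow> real ^ 3 \<Rightarrow> real ^ 3" where
  "boost p x = (1 / (1 - p * x$1)) *\<^sub>R
     (sqrt (1 - p\<^sup>2) *\<^sub>R x + ((1 - sqrt (1 - p\<^sup>2)) * x$1 - p) *\<^sub>R axis 1 1)"

text \<open>The factor \<open>(1 - p * x$1) / k\<close> is the time coordinate of the boosted vector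
  \<open>(x, 1)\<close>; the derivative is the one of the quotient rule.\<close>

lemma hyp_isometry_boost:
  assumes p: "\<bar>p\<bar> < 1"
  defines "k \<equiv> sqrt (1 - p\<^sup>2)"
  shows "hyp_isometry (boost p) (\<lambda>x. (1 - p * x$1) / k)
    (\<lambda>x v. (1 / (1 - p * x$1)) *\<^sub>R (k *\<^sub>R v + ((1 - k) * v$1) *\<^sub>R axis 1 1) +
       (p * v$1 / (1 - p * x$1)\<^sup>2) *\<^sub>R (k *\<^sub>R x + ((1 - k) * x$1 - p) *\<^sub>R axis 1 1))"
proof
  have p2: "p\<^sup>2 < 1" using p by (simp add: abs_square_less_1)
  have k: "k > 0" "k\<^sup>2 = 1 - p\<^sup>2" "k * k = 1 - p * p"
    using p2 by (simp_all add: k_def power2_eq_square flip: power2_eq_square)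
  have E: "1 - p * x$1 > 0" if "norm x < 1" for x :: "real ^ 3"
  proof -
    have "\<bar>p * x$1\<bar> \<le> 1 * norm x"
      unfolding abs_mult using p component_le_norm_cart[of x 1] by (intro mult_mono) auto
    then show ?thesis using that by linarith
  qed
  \<comment> \<open>Cleared of its denominator the boost is affine, so the affinity and Lorentz
    conditions are checked in this form.\<close>
  have B: "(1 - p * x$1) *\<^sub>R boost p x = k *\<^sub>R x + ((1 - k) * x$1 - p) *\<^sub>R axis 1 1"
    if "norm x < 1" for x
    using E[OF that] by (simp add: boost_def k_def)
  show "(1 - p * x$1) / k > 0" if "norm x < 1" for x :: "real ^ 3"
    using E[OF that] k by simp
  show "(1 - p * ((1 - u) *\<^sub>R x + u *\<^sub>R y)$1) / k = (1 - u) * ((1 - p * x$1) / k) + u * ((1 - p * y$1) / k)"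
    for u and x y :: "real ^ 3"
    by (simp add: add_divide_distrib diff_divide_distrib algebra_simps)
  fix x :: "real ^ 3" assume x: "norm x < 1"
  {
    fix y :: "real ^ 3" assume y: "norm y < 1"
    {
      fix u
      let ?z = "(1 - u) *\<^sub>R x + u *\<^sub>R y"
      assume z: "norm ?z < 1"
      have "((1 - p * ?z$1) / k) *\<^sub>R boost p ?z = (1 / k) *\<^sub>R ((1 - p * ?z$1) *\<^sub>R boost p ?z)"
        by simp
      also have "\<dots> = (1 / k) *\<^sub>R ((1 - u) *\<^sub>R ((1 - p * x$1) *\<^sub>R boost p x) + u *\<^sub>R ((1 - p * y$1) *\<^sub>R boost p y))"
        unfolding B[OF z] B[OF x] B[OF y] by (simp add: vec_eq_iff algebra_simps)
      also have "\<dots> = ((1 - u) * ((1 - p * x$1) / k)) *\<^sub>R boost p x + (u * ((1 - p * y$1) / k)) *\<^sub>R boost p y"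
        by (simp add: scaleR_add_right)
      finally show "((1 - p * ?z$1) / k) *\<^sub>R boost p ?z =
        ((1 - u) * ((1 - p * x$1) / k)) *\<^sub>R boost p x + (u * ((1 - p * y$1) / k)) *\<^sub>R boost p y" .
    }
    have "(1 - p * x$1) * (1 - p * y$1) * (boost p x \<bullet> boost p y) =
        ((1 - p * x$1) *\<^sub>R boost p x) \<bullet> ((1 - p * y$1) *\<^sub>R boost p y)"
      by simp
    also have "\<dots> = (x$1 - p) * (y$1 - p) + k\<^sup>2 * (x$2 * y$2 + x$3 * y$3)"
      unfolding B[OF x] B[OF y]
      by (simp add: inner_vec_def sum_3 axis_def algebra_simps power2_eq_square)
    finally have "(1 - boost p x \<bullet> boost p y) * ((1 - p * x$1) * (1 - p * y$1)) = k\<^sup>2 * (1 - x \<bullet> y)"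
      unfolding k by (simp add: inner_vec_def sum_3 algebra_simps power2_eq_square)
    then show "(1 - boost p x \<bullet> boost p y) * ((1 - p * x$1) / k * ((1 - p * y$1) / k)) = 1 - x \<bullet> y"
      using k(1) by (simp add: field_simps power2_eq_square)
  }
  let ?E = "1 - p * x$1"
  let ?g' = "\<lambda>v. (1 / ?E) *\<^sub>R (k *\<^sub>R v + ((1 - k) * v$1) *\<^sub>R axis 1 1) +
       (p * v$1 / ?E\<^sup>2) *\<^sub>R (k *\<^sub>R x + ((1 - k) * x$1 - p) *\<^sub>R axis 1 1) :: real ^ 3"
  show "(boost p has_derivative ?g') (at x)"
    unfolding boost_def [abs_def] k_def[symmetric] using E[OF x]
    by (auto intro!: derivative_eq_intros bounded_linear.has_derivative[OF bounded_linear_vec_nth]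
       simp: fun_eq_iff power2_eq_square)
  \<comment> \<open>The second and third columns of the Jacobian are multiples of unit vectors, so
    only the first entry of the first column enters the determinant.\<close>
  have cols: "?g' (axis 1 1) $ 1 = 1 / ?E + p * (x$1 - p) / ?E\<^sup>2"
    "?g' (axis 2 1) = (k / ?E) *\<^sub>R axis 2 1" "?g' (axis 3 1) = (k / ?E) *\<^sub>R axis 3 1"
    by (simp_all add: axis_def vec_eq_iff algebra_simps flip: add_divide_distrib)
  have "det (matrix ?g') = (1 / ?E + p * (x$1 - p) / ?E\<^sup>2) * (k / ?E) * (k / ?E)"
    unfolding det_3 matrix_def vec_lambda_beta cols by (simp add: axis_def)
  also have "1 / ?E + p * (x$1 - p) / ?E\<^sup>2 = k\<^sup>2 / ?E\<^sup>2"
  proof -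
    have "1 / ?E = ?E / ?E\<^sup>2" using E[OF x] by (simp add: power2_eq_square)
    then have "1 / ?E + p * (x$1 - p) / ?E\<^sup>2 = (?E + p * (x$1 - p)) / ?E\<^sup>2"
      by (simp only: add_divide_distrib)
    also have "?E + p * (x$1 - p) = k\<^sup>2" unfolding k by (simp add: algebra_simps power2_eq_square)
    finally show ?thesis .
  qed
  also have "k\<^sup>2 / ?E\<^sup>2 * (k / ?E) * (k / ?E) = k ^ 4 / ?E ^ 4"
    by (simp add: power4_eq_xxxx power2_eq_square mult.assoc)
  finally have "det (matrix ?g') = k ^ 4 / ?E ^ 4" .
  then show "\<bar>det (matrix ?g')\<bar> * (?E / k) ^ 4 = 1"
    using E[OF x] k(1) by (simp add: power_divide)
qed

subsection \<open>Reduction to a standard position\<close>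

text \<open>Expresses orthogonality through the Lorentz products \<open>1 - x \<bullet> y\<close>
  alone, whose behaviour under isometries is given by \<open>lorentz\<close>.\<close>

lemma hyp_orthogonal_at_iff:
  assumes P: "norm P < 1"
  shows "hyp_orthogonal_at P X Y \<longleftrightarrow> (1 - X \<bullet> Y) * (1 - P \<bullet> P) = (1 - P \<bullet> X) * (1 - P \<bullet> Y)"
proof -
  define m where "m = 1 - P \<bullet> P"
  have m: "m > 0" using P by (simp add: m_def power_less_one_iff flip: power2_norm_eq_inner)
  have "hyp_metric P (X - P) (Y - P) =
      ((X - P) \<bullet> (Y - P) * m + (P \<bullet> (X - P)) * (P \<bullet> (Y - P))) / m\<^sup>2"
    using m unfolding hyp_metric_def power2_norm_eq_inner m_def[symmetric]
    by (simp add: field_simps power2_eq_square)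
  also have "(X - P) \<bullet> (Y - P) * m + (P \<bullet> (X - P)) * (P \<bullet> (Y - P)) =
      (1 - P \<bullet> X) * (1 - P \<bullet> Y) - (1 - X \<bullet> Y) * m"
    unfolding m_def by (simp add: inner_simps inner_commute algebra_simps)
  finally show ?thesis
    using m by (auto simp: hyp_orthogonal_at_def m_def)
qed

text \<open>Orthogonality to the base plane is recorded at the vertices \<open>A0\<close> and
  \<open>A1\<close> only: these are finitely many conditions on points of the ball, each of which an
  isometry transports.\<close>

definition orthoscheme_vertices ::
    "real ^ 3 \<Rightarrow> real ^ 3 \<Rightarrow> real ^ 3 \<Rightarrow> real ^ 3 \<Rightarrow> real \<Rightarrow> real \<Rightarrow> real \<Rightarrow> bool" where
  "orthoscheme_vertices A0 A1 A2 A3 a b c \<longleftrightarrow>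
     norm A0 < 1 \<and> norm A1 < 1 \<and> norm A2 < 1 \<and> norm A3 < 1 \<and>
     hyp_dist A0 A1 = a \<and> hyp_dist A1 A2 = b \<and> hyp_dist A2 A3 = c \<and>
     hyp_orthogonal_at A1 A0 A2 \<and> hyp_orthogonal_at A2 A0 A3 \<and> hyp_orthogonal_at A2 A1 A3"

lemma is_orthoscheme_imp_vertices:
  assumes "is_orthoscheme A0 A1 A2 A3 a b c"
  shows "orthoscheme_vertices A0 A1 A2 A3 a b c"
proof -
  have "A0 \<in> hyp_span {A0, A1, A2}" "A1 \<in> hyp_span {A0, A1, A2}"
    using assms by (auto simp: is_orthoscheme_def hyp_span_def hull_inc)
  then show ?thesis
    using assms by (auto simp: is_orthoscheme_def orthoscheme_vertices_def hyp_space_def)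
qed

context hyp_isometry
begin

text \<open>Both sides of the criterion \<open>hyp_orthogonal_at_iff\<close> are divided by the same
  product \<open>e P * e P * (e X * e Y)\<close>.\<close>

lemma hyp_orthogonal_at_image:
  assumes P: "norm P < 1" and X: "norm X < 1" and Y: "norm Y < 1" and o: "hyp_orthogonal_at P X Y"
  shows "hyp_orthogonal_at (g P) (g X) (g Y)"
proof -
  have "(1 - X \<bullet> Y) * (1 - P \<bullet> P) = (1 - P \<bullet> X) * (1 - P \<bullet> Y)"
    using o hyp_orthogonal_at_iff[OF P] by blast
  then have "(1 - X \<bullet> Y) * (1 - P \<bullet> P) / (e P * e P * (e X * e Y)) =
      (1 - P \<bullet> X) * (1 - P \<bullet> Y) / (e P * e P * (e X * e Y))" by simp
  then show ?thesis
    unfolding hyp_orthogonal_at_iff[OF norm_image[OF P]]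
    by (simp add: lorentz_eq P X Y mult_ac)
qed

lemma orthoscheme_vertices_image:
  assumes "orthoscheme_vertices A0 A1 A2 A3 a b c"
  shows "orthoscheme_vertices (g A0) (g A1) (g A2) (g A3) a b c"
  using assms unfolding orthoscheme_vertices_def
  by (auto simp: norm_image hyp_dist_image intro: hyp_orthogonal_at_image)

lemma measure_orthoscheme_image:
  assumes "orthoscheme_vertices A0 A1 A2 A3 a b c"
  shows "measure hyp_volume (convex hull {g A0, g A1, g A2, g A3}) =
    measure hyp_volume (convex hull {A0, A1, A2, A3})"
proof -
  let ?T = "convex hull {A0, A1, A2, A3}"
  have b: "{A0, A1, A2, A3} \<subseteq> ball 0 1"
    using assms by (auto simp: orthoscheme_vertices_def)
  then have "?T \<subseteq> hyp_space" unfolding hyp_space_def by (intro hull_minimal) auto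
  moreover have "compact ?T" by (simp add: finite_imp_compact_convex_hull)
  ultimately show ?thesis
    using measure_image[of ?T] convex_hull_image[OF b] by simp
qed

end

lemma boost_self: "boost p (p *\<^sub>R axis 1 1) = 0"
  by (simp add: boost_def algebra_simps)

text \<open>An orthogonal map takes \<open>A1\<close> to the first axis and the boost of velocity
  \<open>norm A1\<close> takes it to \<open>0\<close>, where hyperbolic orthogonality is
  Euclidean.\<close>

lemma orthoscheme_at_origin:
  assumes "orthoscheme_vertices A0 A1 A2 A3 a b c"
  obtains B0 B2 B3 where "orthoscheme_vertices B0 0 B2 B3 a b c"
    "measure hyp_volume (convex hull {A0, A1, A2, A3}) =
     measure hyp_volume (convex hull {B0, 0, B2, B3})"
proof -
  have "norm A1 = norm (norm A1 *\<^sub>R axis 1 1 :: real ^ 3)" by simp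
  from orthogonal_transformation_exists[OF this]
  obtain f :: "real ^ 3 \<Rightarrow> real ^ 3" where f: "orthogonal_transformation f" "f A1 = norm A1 *\<^sub>R axis 1 1" by blast
  interpret f: hyp_isometry f "\<lambda>_. 1" "\<lambda>_. f" by (rule hyp_isometry_orthogonal[OF f(1)])
  define p where "p = norm A1"
  have p: "\<bar>p\<bar> < 1" using assms by (simp add: p_def orthoscheme_vertices_def)
  note g = hyp_isometry_boost[OF p]
  note fo = f.orthoscheme_vertices_image[OF assms]
  have z: "boost p (f A1) = 0" using boost_self[of p] by (simp add: f(2) p_def)
  show ?thesis
  proof (rule that)
    show "orthoscheme_vertices (boost p (f A0)) 0 (boost p (f A2)) (boost p (f A3)) a b c"
      using hyp_isometry.orthoscheme_vertices_image[OF g fo] by (simp only: z)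
    show "measure hyp_volume (convex hull {A0, A1, A2, A3}) =
      measure hyp_volume (convex hull {boost p (f A0), 0, boost p (f A2), boost p (f A3)})"
      using hyp_isometry.measure_orthoscheme_image[OF g fo] f.measure_orthoscheme_image[OF assms]
      by (simp only: z)
  qed
qed

text \<open>Recovers a squared norm from a distance. The bounds on \<open>r\<close> put the argument
  of \<open>arcosh\<close> in \<open>[1, \<infinity>)\<close>, where \<open>cosh\<close> inverts
  it.\<close>

lemma inverse_sqrt_eq_cosh:
  fixes r a :: real
  assumes r: "0 < r" "r \<le> 1" and a: "arcosh (1 / sqrt r) = a"
  shows "r = 1 / (cosh a)\<^sup>2"
proof -
  have "1 / sqrt r \<ge> 1" using r by simp
  then have "cosh a = 1 / sqrt r" using a cosh_arcosh_real by blast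
  then show ?thesis using r by (simp add: power_divide)
qed

text \<open>The conditions make \<open>B0\<close>, \<open>B2\<close> and \<open>B3 - B2\<close>
  pairwise orthogonal in the Euclidean sense, of lengths \<open>tanh a\<close>,
  \<open>tanh b\<close> and \<open>tanh c / cosh b\<close>; an orthogonal map then takes them to the
  coordinate axes.\<close>

lemma orthoscheme_canonical:
  assumes a: "a > 0" and b: "b > 0" and c: "c > 0" and o: "orthoscheme_vertices B0 0 B2 B3 a b c"
  shows "measure hyp_volume (convex hull {B0, 0, B2, B3}) =
    measure hyp_volume (convex hull {vector [tanh a, 0, 0], 0, vector [0, tanh b, 0],
      vector [0, tanh b, tanh c / cosh b] :: real ^ 3})"
proof -
  have n0: "norm B0 < 1" and n2: "norm B2 < 1" and n3: "norm B3 < 1"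
    and d0: "hyp_dist B0 0 = a" and d2: "hyp_dist 0 B2 = b" and d3: "hyp_dist B2 B3 = c"
    using o by (auto simp: orthoscheme_vertices_def)
  have sq1: "1 - (norm x)\<^sup>2 > 0" "1 - (norm x)\<^sup>2 \<le> 1" if "norm x < 1" for x :: "real ^ 3"
    using that by (simp_all add: power_less_one_iff)
  have tanh2: "(tanh t)\<^sup>2 = 1 - 1 / (cosh t)\<^sup>2" for t :: real
    using one_minus_tanh_square[of t] by simp
  have "1 - (norm B0)\<^sup>2 = 1 / (cosh a)\<^sup>2"
    using d0 by (intro inverse_sqrt_eq_cosh sq1 n0) (simp add: hyp_dist_def)
  then have "(norm B0)\<^sup>2 = (tanh a)\<^sup>2" unfolding tanh2 by simp
  then have N0: "norm B0 = tanh a" using a by (metis norm_ge_zero power2_eq_imp_eq tanh_real_nonneg_iff less_imp_le)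
  have q2: "1 - (norm B2)\<^sup>2 = 1 / (cosh b)\<^sup>2"
    using d2 by (intro inverse_sqrt_eq_cosh sq1 n2) (simp add: hyp_dist_def)
  then have "(norm B2)\<^sup>2 = (tanh b)\<^sup>2" unfolding tanh2 by simp
  then have N2: "norm B2 = tanh b" using b by (metis norm_ge_zero power2_eq_imp_eq tanh_real_nonneg_iff less_imp_le)
  have o02: "B0 \<bullet> B2 = 0"
    using o hyp_orthogonal_at_iff[of 0 B0 B2] by (simp add: orthoscheme_vertices_def)
  have o23: "B2 \<bullet> B3 = (norm B2)\<^sup>2"
    using o hyp_orthogonal_at_iff[OF n2, of 0 B3]
    by (simp add: orthoscheme_vertices_def power2_norm_eq_inner)
  have "(1 - B0 \<bullet> B3) * (1 - (norm B2)\<^sup>2) = 1 - (norm B2)\<^sup>2"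
    using o hyp_orthogonal_at_iff[OF n2, of B0 B3] o02
    by (simp add: orthoscheme_vertices_def power2_norm_eq_inner[symmetric] o23 inner_commute)
  then have o03: "B0 \<bullet> B3 = 0" using sq1(1)[OF n2] by simp
  define w where "w = B3 - B2"
  have w2: "(norm w)\<^sup>2 = (norm B3)\<^sup>2 - (norm B2)\<^sup>2"
    using o23 by (simp add: w_def power2_norm_eq_inner inner_simps inner_commute)
  have ow: "B0 \<bullet> w = 0" "B2 \<bullet> w = 0"
    using o02 o03 o23 by (simp_all add: w_def inner_diff_right power2_norm_eq_inner)
  \<comment> \<open>As \<open>B2 \<bullet> B3 = norm B2 ^ 2\<close>, the numerator of
    \<open>hyp_dist B2 B3\<close> is \<open>1 - norm B2 ^ 2\<close>, and \<open>1 / cosh c\<close>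
    becomes the square root of this quotient.\<close>
  have "(1 - (norm B3)\<^sup>2) / (1 - (norm B2)\<^sup>2) = 1 / (cosh c)\<^sup>2"
  proof (intro inverse_sqrt_eq_cosh)
    have "(norm B2)\<^sup>2 \<le> (norm B3)\<^sup>2" using w2 zero_le_power2[of "norm w"] by linarith
    then show "(1 - (norm B3)\<^sup>2) / (1 - (norm B2)\<^sup>2) \<le> 1" using sq1[OF n2] by simp
    show "0 < (1 - (norm B3)\<^sup>2) / (1 - (norm B2)\<^sup>2)" using sq1(1)[OF n2] sq1(1)[OF n3] by simp
    have "(1 - (norm B2)\<^sup>2) / (sqrt (1 - (norm B2)\<^sup>2) * sqrt (1 - (norm B3)\<^sup>2)) =
        1 / sqrt ((1 - (norm B3)\<^sup>2) / (1 - (norm B2)\<^sup>2))"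
      using sq1(1)[OF n2] sq1(1)[OF n3] by (simp add: real_sqrt_divide real_div_sqrt flip: divide_divide_eq_left)
    then show "arcosh (1 / sqrt ((1 - (norm B3)\<^sup>2) / (1 - (norm B2)\<^sup>2))) = c"
      using d3 by (simp add: hyp_dist_def o23)
  qed
  then have "1 - (norm B3)\<^sup>2 = 1 / (cosh b)\<^sup>2 * (1 / (cosh c)\<^sup>2)"
    unfolding q2 by (simp add: field_simps)
  then have "(norm w)\<^sup>2 = (tanh c / cosh b)\<^sup>2"
    using w2 q2 by (simp add: power_divide tanh2[of c] algebra_simps diff_divide_distrib)
  then have Nw: "norm w = tanh c / cosh b"
    by (rule power2_eq_imp_eq) (use c in simp_all)
  \<comment> \<open>The rows are the normalised orthogonal vectors, so \<open>U\<close> takes each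
    of them to a unit vector.\<close>
  define U :: "real ^ 3 ^ 3" where
    "U = vector [B0 /\<^sub>R tanh a, B2 /\<^sub>R tanh b, w /\<^sub>R (tanh c / cosh b)]"
  have pos: "tanh a > 0" "tanh b > 0" "tanh c / cosh b > 0" using a b c by simp_all
  have sq: "B0 \<bullet> B0 = tanh a * tanh a" "B2 \<bullet> B2 = tanh b * tanh b"
    "w \<bullet> w = tanh c / cosh b * (tanh c / cosh b)"
    by (simp_all only: N0 N2 Nw dot_square_norm power2_eq_square)
  have "orthogonal_matrix U"
    unfolding orthogonal_matrix_orthonormal_rows
    using pos c N0 N2 Nw o02 ow
    by (auto simp: U_def row_def orthogonal_def forall_3 inner_commute vec_nth_inverse)
  then have f: "orthogonal_transformation ((*v) U)"
    by (simp add: orthogonal_transformation_matrix)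
  interpret hyp_isometry "(*v) U" "\<lambda>_. 1" "\<lambda>_. (*v) U" by (rule hyp_isometry_orthogonal[OF f])
  have U: "U *v x = vector [(B0 \<bullet> x) / tanh a, (B2 \<bullet> x) / tanh b, (w \<bullet> x) / (tanh c / cosh b)]" for x
    by (simp add: vec_eq_iff forall_3 matrix_vector_mult_def U_def inner_vec_def sum_3 sum_divide_distrib
      add_divide_distrib field_simps)
  have B3: "B3 = B2 + w" by (simp add: w_def)
  have "U *v B0 = vector [tanh a, 0, 0]" "U *v 0 = 0" "U *v B2 = vector [0, tanh b, 0]"
    "U *v B3 = vector [0, tanh b, tanh c / cosh b]"
    using pos unfolding B3 U
    by (simp_all add: vec_eq_iff forall_3 inner_add_right sq o02 ow inner_commute)
  with measure_orthoscheme_image[OF o] show ?thesis by simp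
qed

subsection \<open>The orthoscheme in standard position\<close>

text \<open>Lebesgue measure is determined by its values on boxes, and the coordinate map pulls a
  box back to a product of intervals. This brings Tonelli to \<open>real ^ 3\<close>.\<close>

lemma lborel_real3:
  "distr (lborel \<Otimes>\<^sub>M lborel \<Otimes>\<^sub>M lborel) borel (\<lambda>(x, y, z). vector [x, y, z] :: real ^ 3) = lborel"
    (is "?D = _")
proof (rule lborel_eqI[symmetric])
  let ?v = "\<lambda>(x, y, z). vector [x, y, z] :: real ^ 3"
  fix l u :: "real ^ 3"
  assume lu: "\<And>b. b \<in> Basis \<Longrightarrow> l \<bullet> b \<le> u \<bullet> b"
  have le: "l $ i \<le> u $ i" for i
    using lu[of "axis i 1"] by (simp add: inner_axis)
  have "?v -` box l u = box (l$1) (u$1) \<times> box (l$2) (u$2) \<times> box (l$3) (u$3)"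
    by (auto simp: mem_box_cart forall_3)
  then have "emeasure ?D (box l u) = emeasure (lborel \<Otimes>\<^sub>M lborel \<Otimes>\<^sub>M lborel)
      (box (l$1) (u$1) \<times> box (l$2) (u$2) \<times> box (l$3) (u$3))"
    by (subst emeasure_distr[OF measurable_vector3]) (auto simp: space_pair_measure)
  also have "\<dots> = ennreal (u$1 - l$1) * (ennreal (u$2 - l$2) * ennreal (u$3 - l$3))"
    using le by (simp add: lborel_pair.P.emeasure_pair_measure_Times lborel.emeasure_pair_measure_Times emeasure_lborel_box_eq
        del: box_real)
  also have "\<dots> = (\<Prod>b\<in>Basis. (u - l) \<bullet> b)"
  proof -
    have "(\<Prod>b\<in>Basis. (u - l) \<bullet> b) = (\<Prod>i\<in>UNIV. (u - l) $ i)"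
      by (simp add: Basis_vec_def UNION_singleton_eq_range prod.reindex axis_eq_axis inj_on_def inner_axis)
    also have "\<dots> = (u$1 - l$1) * ((u$2 - l$2) * (u$3 - l$3))"
      unfolding UNIV_3 by simp
    finally show ?thesis
      using le by (simp add: ennreal_mult)
  qed
  finally show "emeasure ?D (box l u) = (\<Prod>b\<in>Basis. (u - l) \<bullet> b)" .
qed simp

lemma nn_integral_real3:
  fixes f :: "real ^ 3 \<Rightarrow> ennreal"
  assumes f: "f \<in> borel_measurable borel"
  shows "(\<integral>\<^sup>+v. f v \<partial>lborel) =
    (\<integral>\<^sup>+x. \<integral>\<^sup>+y. \<integral>\<^sup>+z. f (vector [x, y, z]) \<partial>lborel \<partial>lborel \<partial>lborel)"
proof -
  let ?v = "\<lambda>(x, y, z). vector [x, y, z] :: real ^ 3"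
  have fm: "(\<lambda>p. f (?v p)) \<in> borel_measurable (lborel \<Otimes>\<^sub>M lborel \<Otimes>\<^sub>M lborel)"
    using measurable_compose[OF measurable_vector3 f] .
  have fx: "(\<lambda>q. f (?v (x, q))) \<in> borel_measurable (lborel \<Otimes>\<^sub>M lborel)" for x
    using measurable_compose[OF measurable_Pair1' fm] by simp
  have "(\<integral>\<^sup>+v. f v \<partial>lborel) = (\<integral>\<^sup>+p. f (?v p) \<partial>(lborel \<Otimes>\<^sub>M lborel \<Otimes>\<^sub>M lborel))"
    by (subst lborel_real3[symmetric]) (rule nn_integral_distr[OF measurable_vector3], simp add: f)
  also have "\<dots> = (\<integral>\<^sup>+x. \<integral>\<^sup>+q. f (?v (x, q)) \<partial>(lborel \<Otimes>\<^sub>M lborel) \<partial>lborel)"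
    by (rule lborel_pair.P.nn_integral_fst[symmetric, OF fm])
  also have "\<dots> = (\<integral>\<^sup>+x. \<integral>\<^sup>+y. \<integral>\<^sup>+z. f (?v (x, y, z)) \<partial>lborel \<partial>lborel \<partial>lborel)"
    by (intro nn_integral_cong lborel.nn_integral_fst[symmetric, OF fx])
  finally show ?thesis by simp
qed

section \<open>Antiderivatives for the fiber and the slice\<close>

text \<open>With \<open>z = sqrt N * tanh h\<close> the antiderivative is
  \<open>(h + sinh h * cosh h) / (2 * N * sqrt N)\<close>.\<close>

lemma has_real_derivative_fiber:
  fixes N z :: real
  assumes N: "N > 0" and z: "z\<^sup>2 < N"
  shows "((\<lambda>z. z / (2 * N * (N - z\<^sup>2)) + artanh (z / sqrt N) / (2 * N * sqrt N))
    has_real_derivative 1 / (N - z\<^sup>2)\<^sup>2) (at z)"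
proof -
  have s: "sqrt N > 0" "sqrt N * sqrt N = N" using N by simp_all
  have small: "\<bar>z / sqrt N\<bar> < 1"
    using real_sqrt_less_mono[OF z] s by (simp add: field_simps)
  have one: "1 - (z / sqrt N)\<^sup>2 = (N - z\<^sup>2) / N"
    using N by (simp add: power_divide diff_divide_distrib)
  have d: "((\<lambda>z. artanh (z / sqrt N)) has_real_derivative N / (N - z\<^sup>2) * (1 / sqrt N)) (at z)"
    using DERIV_chain2[OF artanh_real_has_field_derivative[OF small] DERIV_cdivide[OF DERIV_ident]]
    by (simp add: one)
  have eq: "(N + z\<^sup>2) / (2 * N * (N - z\<^sup>2)\<^sup>2) + N / (N - z\<^sup>2) * (1 / sqrt N) / (2 * N * sqrt N) = 1 / (N - z\<^sup>2)\<^sup>2"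
  proof -
    have "N / (N - z\<^sup>2) * (1 / sqrt N) / (2 * N * sqrt N) = 1 / ((N - z\<^sup>2) * (2 * (sqrt N * sqrt N)))"
      using N by simp
    also have "\<dots> = (N - z\<^sup>2) / (2 * N * (N - z\<^sup>2)\<^sup>2)"
      unfolding s using z by (simp add: power2_eq_square)
    finally have "(N + z\<^sup>2) / (2 * N * (N - z\<^sup>2)\<^sup>2) + N / (N - z\<^sup>2) * (1 / sqrt N) / (2 * N * sqrt N) =
        ((N + z\<^sup>2) + (N - z\<^sup>2)) / (2 * N * (N - z\<^sup>2)\<^sup>2)"
      by (simp only: add_divide_distrib)
    also have "(N + z\<^sup>2) + (N - z\<^sup>2) = 2 * N" by simp
    finally show ?thesis using N by simp
  qed
  define D where "D = N - z\<^sup>2"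
  have D: "D > 0" using z by (simp add: D_def)
  have "((\<lambda>z. z / (2 * N * (N - z\<^sup>2))) has_real_derivative
      (2 * N * D - z * (2 * N * (- (2 * z)))) / (2 * N * D)\<^sup>2) (at z)"
    using N D unfolding D_def
    by (auto intro!: derivative_eq_intros simp: power2_eq_square)
  also have "2 * N * D - z * (2 * N * (- (2 * z))) = 2 * N * (N + z\<^sup>2)"
    by (simp add: D_def algebra_simps power2_eq_square)
  also have "2 * N * (N + z\<^sup>2) / (2 * N * D)\<^sup>2 = (N + z\<^sup>2) / (2 * N * D\<^sup>2)"
  proof -
    have sq: "(2 * N * D)\<^sup>2 = (2 * N) * (2 * N * D\<^sup>2)" by (simp add: power2_eq_square)
    show ?thesis unfolding sq using N by (subst mult_divide_mult_cancel_left) simp_all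
  qed
  finally have "((\<lambda>z. z / (2 * N * (N - z\<^sup>2))) has_real_derivative (N + z\<^sup>2) / (2 * N * (N - z\<^sup>2)\<^sup>2)) (at z)"
    unfolding D_def .
  from DERIV_add[OF this DERIV_cdivide[OF d, of "2 * N * sqrt N"]] show ?thesis
    unfolding eq .
qed

lemma has_integral_fiber:
  fixes N h :: real
  assumes h: "0 \<le> h" "h\<^sup>2 < N"
  shows "((\<lambda>z. 1 / (N - z\<^sup>2)\<^sup>2) has_integral
    h / (2 * N * (N - h\<^sup>2)) + artanh (h / sqrt N) / (2 * N * sqrt N)) {0..h}"
proof -
  have N: "N > 0" using h(2) zero_le_power2[of h] by linarith
  have "z\<^sup>2 < N" if "z \<in> {0..h}" for z
  proof -
    have "z\<^sup>2 \<le> h\<^sup>2" using that by (intro power_mono) auto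
    then show ?thesis using h(2) by linarith
  qed
  then have "((\<lambda>z. 1 / (N - z\<^sup>2)\<^sup>2) has_integral
     (h / (2 * N * (N - h\<^sup>2)) + artanh (h / sqrt N) / (2 * N * sqrt N)) -
     (0 / (2 * N * (N - 0\<^sup>2)) + artanh (0 / sqrt N) / (2 * N * sqrt N))) {0..h}"
    using h(1)
    by (intro fundamental_theorem_of_calculus)
      (auto intro: DERIV_subset[OF has_real_derivative_fiber[OF N]]
        simp flip: has_real_derivative_iff_has_vector_derivative)
  then show ?thesis by simp
qed

text \<open>
  With \<open>M = 1 - x\<^sup>2\<close> this is \<open>1/2 * h * sinh \<lambda> / (1 - x\<^sup>2)\<close>, in the Klein coordinates \<open>x = tanh s\<close> and
  \<open>y = tanh \<lambda> / cosh s\<close>; the factor \<open>1 / (1 - x\<^sup>2)\<close> is \<open>ds/dx\<close>.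
\<close>

lemma has_real_derivative_slice:
  fixes M k y :: real
  assumes M: "M > 0" and k: "k \<ge> 0" and y: "0 \<le> y" "(1 + k\<^sup>2) * y\<^sup>2 < M"
  defines "N \<equiv> M - y\<^sup>2"
  shows "((\<lambda>y. y / sqrt (M - y\<^sup>2) * artanh (k * y / sqrt (M - y\<^sup>2)) / (2 * M)) has_real_derivative
    k * y / (2 * N * (N - (k * y)\<^sup>2)) + artanh (k * y / sqrt N) / (2 * N * sqrt N)) (at y)"
proof -
  have kN: "(k * y)\<^sup>2 < N" using y by (simp add: N_def algebra_simps power_mult_distrib)
  have N: "N > 0" using kN zero_le_power2[of "k * y"] by linarith
  define n where "n = sqrt N"
  have n: "n > 0" "n * n = N" "n\<^sup>2 = N" using N by (simp_all add: n_def)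
  have small: "\<bar>k * (y / n)\<bar> < 1"
  proof -
    have "sqrt ((k * y)\<^sup>2) < n" unfolding n_def by (rule real_sqrt_less_mono[OF kN])
    then have "\<bar>k * y\<bar> < n" by (simp only: real_sqrt_abs)
    then show ?thesis using n(1) by (simp add: abs_mult field_simps)
  qed
  \<comment> \<open>The differentiated quotient is \<open>sinh \<lambda>\<close>; the argument of
    \<open>artanh\<close> is \<open>k\<close> times it.\<close>
  have dn: "((\<lambda>y. y / sqrt (M - y\<^sup>2)) has_real_derivative M / (N * n)) (at y)"
  proof -
    have "((\<lambda>y. y / sqrt (M - y\<^sup>2)) has_real_derivative (n - y * (- y / n)) / N) (at y)"
      using N n by (auto intro!: derivative_eq_intros simp: N_def[symmetric] n_def[symmetric] divide_simps)
    also have "(n - y * (- y / n)) / N = (N + y\<^sup>2) / (N * n)"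
      using n(1) by (simp add: divide_simps power2_eq_square flip: n(2))
    finally show ?thesis by (simp add: N_def)
  qed
  have nM: "n = sqrt (M - y\<^sup>2)" by (simp add: n_def N_def)
  have one: "1 - (k * (y / sqrt (M - y\<^sup>2)))\<^sup>2 = (N - (k * y)\<^sup>2) / N"
    unfolding nM[symmetric] using N by (simp add: power_divide power_mult_distrib n diff_divide_distrib)
  have da: "((\<lambda>y. artanh (k * (y / sqrt (M - y\<^sup>2)))) has_real_derivative
      N / (N - (k * y)\<^sup>2) * (k * (M / (N * n)))) (at y)"
    using DERIV_chain2[OF artanh_real_has_field_derivative[OF small[unfolded nM]] DERIV_cmult[OF dn, of k]]
    by (simp only: one divide_divide_eq_right mult_1)
  have "((\<lambda>y. y / sqrt (M - y\<^sup>2) * artanh (k * (y / sqrt (M - y\<^sup>2))) / (2 * M)) has_real_derivative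
     (M / (N * n) * artanh (k * (y / n)) +
       N / (N - (k * y)\<^sup>2) * (k * (M / (N * n))) * (y / n)) / (2 * M)) (at y)"
    using DERIV_cdivide[OF DERIV_mult[OF dn da], of "2 * M"]
    by (simp add: N_def[symmetric] n_def[symmetric])
  also have "(M / (N * n) * artanh (k * (y / n)) +
       N / (N - (k * y)\<^sup>2) * (k * (M / (N * n))) * (y / n)) / (2 * M) =
     k * y / (2 * (n * n) * (N - (k * y)\<^sup>2)) + artanh (k * y / n) / (2 * N * n)"
    using M N n(1) kN by (simp add: divide_simps) (simp add: algebra_simps)
  finally show ?thesis by (simp add: n(2)) (simp add: n_def)
qed

text \<open>The integrand is the value from \<open>has_integral_fiber\<close> for
  \<open>N = M - y^2\<close> and \<open>h = k * y\<close>; its antiderivative vanishes at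
  \<open>y = 0\<close>.\<close>

lemma has_integral_slice:
  fixes M k Y :: real
  assumes M: "M > 0" and k: "k \<ge> 0" and Y: "0 \<le> Y" "(1 + k\<^sup>2) * Y\<^sup>2 < M"
  shows "((\<lambda>y. k * y / (2 * (M - y\<^sup>2) * (M - y\<^sup>2 - (k * y)\<^sup>2)) +
      artanh (k * y / sqrt (M - y\<^sup>2)) / (2 * (M - y\<^sup>2) * sqrt (M - y\<^sup>2))) has_integral
    Y / sqrt (M - Y\<^sup>2) * artanh (k * Y / sqrt (M - Y\<^sup>2)) / (2 * M)) {0..Y}"
proof -
  have small: "(1 + k\<^sup>2) * y\<^sup>2 < M" if "y \<in> {0..Y}" for y
  proof -
    have "(1 + k\<^sup>2) * y\<^sup>2 \<le> (1 + k\<^sup>2) * Y\<^sup>2"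
      using that by (intro mult_left_mono power_mono) auto
    then show ?thesis using Y(2) by linarith
  qed
  let ?G = "\<lambda>y. y / sqrt (M - y\<^sup>2) * artanh (k * y / sqrt (M - y\<^sup>2)) / (2 * M)"
  have "((\<lambda>y. k * y / (2 * (M - y\<^sup>2) * (M - y\<^sup>2 - (k * y)\<^sup>2)) +
      artanh (k * y / sqrt (M - y\<^sup>2)) / (2 * (M - y\<^sup>2) * sqrt (M - y\<^sup>2))) has_integral
     ?G Y - ?G 0) {0..Y}"
  proof (rule fundamental_theorem_of_calculus[OF Y(1)])
    fix y assume y: "y \<in> {0..Y}"
    show "(?G has_vector_derivative k * y / (2 * (M - y\<^sup>2) * (M - y\<^sup>2 - (k * y)\<^sup>2)) +
      artanh (k * y / sqrt (M - y\<^sup>2)) / (2 * (M - y\<^sup>2) * sqrt (M - y\<^sup>2))) (at y within {0..Y})"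
      unfolding has_real_derivative_iff_has_vector_derivative[symmetric]
      using y by (intro has_real_derivative_slice[THEN has_field_derivative_at_within] M k small) simp_all
  qed
  then show ?thesis by simp
qed

section \<open>The tetrahedron in coordinates\<close>

locale canonical_orthoscheme =
  fixes a b c :: real
  assumes a: "a > 0" and b: "b > 0" and c: "c > 0"
begin

text \<open>The slope of the upper face \<open>z = k * y\<close>; also
  \<open>k * sinh \<lambda>\<close> is the \<open>tanh\<close> of the fiber length at distance
  \<open>\<lambda>\<close> from \<open>A0A1\<close>.\<close>

definition "k = tanh c / sinh b"

definition T :: "(real ^ 3) set" where
  "T = convex hull {vector [tanh a, 0, 0], 0, vector [0, tanh b, 0], vector [0, tanh b, tanh c / cosh b]}"

text \<open>The line of the hypotenuse \<open>A0A2\<close>, through \<open>(tanh a, 0)\<close> and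
  \<open>(0, tanh b)\<close>.\<close>

definition Y :: "real \<Rightarrow> real" where "Y x = tanh b * (1 - x / tanh a)"

lemma k_pos: "k > 0" using b c by (simp add: k_def)

lemma k_tanh: "k * tanh b = tanh c / cosh b"
  using b by (simp add: k_def tanh_def)

text \<open>Forwards, the vertices lie in the four half-spaces bounded by the faces; backwards,
  barycentric coordinates are given. The inequality \<open>0 \<le> y\<close> is implied by
  \<open>0 \<le> z \<le> k * y\<close>.\<close>

lemma mem_T_iff: "vector [x, y, z] \<in> T \<longleftrightarrow> 0 \<le> x \<and> y \<le> Y x \<and> 0 \<le> z \<and> z \<le> k * y"
proof
  have pos: "tanh a > 0" "tanh b > 0" "tanh c > 0" "cosh b > 0" using a b c by simp_all
  have YY: "y \<le> Y x \<longleftrightarrow> x / tanh a + y / tanh b \<le> 1" for x y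
    using pos by (simp add: Y_def field_simps)
  let ?C = "{v :: real ^ 3. vector [-1, 0, 0] \<bullet> v \<le> 0} \<inter> {v. vector [1 / tanh a, 1 / tanh b, 0] \<bullet> v \<le> 1} \<inter>
     {v. vector [0, 0, -1] \<bullet> v \<le> 0} \<inter> {v. vector [0, -k, 1] \<bullet> v \<le> 0}"
  have "convex ?C" by (intro convex_Int convex_halfspace_le)
  moreover have "{vector [tanh a, 0, 0], 0, vector [0, tanh b, 0], vector [0, tanh b, tanh c / cosh b]} \<subseteq> ?C"
    using pos k_pos k_tanh by (auto simp: inner_vec_def sum_3)
  ultimately have "T \<subseteq> ?C" unfolding T_def by (rule hull_minimal[rotated])
  moreover assume "vector [x, y, z] \<in> T"
  ultimately have "vector [x, y, z] \<in> ?C" by blast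
  then show "0 \<le> x \<and> y \<le> Y x \<and> 0 \<le> z \<and> z \<le> k * y"
    by (simp add: inner_vec_def sum_3 YY)
next
  have pos: "tanh a > 0" "tanh b > 0" "tanh c / cosh b > 0" using a b c by simp_all
  assume h: "0 \<le> x \<and> y \<le> Y x \<and> 0 \<le> z \<and> z \<le> k * y"
  define p :: "nat \<Rightarrow> real ^ 3" where "p = (!) [vector [tanh a, 0, 0], 0, vector [0, tanh b, 0],
    vector [0, tanh b, tanh c / cosh b]]"
  \<comment> \<open>The barycentric coordinates of \<open>(x, y, z)\<close>, in the order of the
    vertices in \<open>p\<close>.\<close>
  define u where "u = (!) [x / tanh a, 1 - x / tanh a - y / tanh b, y / tanh b - z / (tanh c / cosh b),
    z / (tanh c / cosh b)]"
  have S: "{..<4} = {0, 1, 2, 3 :: nat}" by auto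
  have "y / tanh b \<le> 1 - x / tanh a" using h pos by (simp add: Y_def pos_divide_le_eq mult.commute)
  moreover have "z / (tanh c / cosh b) \<le> y / tanh b"
    unfolding k_tanh[symmetric] using h pos k_pos by (simp add: pos_divide_le_eq pos_le_divide_eq mult.commute)
  ultimately have nn: "\<And>i. i \<in> {..<4} \<Longrightarrow> u i \<ge> 0"
    using h pos c unfolding S by (auto simp: u_def)
  have "(\<Sum>i<4. u i *\<^sub>R p i) \<in> T"
    unfolding T_def using nn
    by (intro convex_sum) (auto simp: S u_def p_def intro!: hull_inc)
  also have "(\<Sum>i<4. u i *\<^sub>R p i) = vector [x, y, z]"
    using pos by (simp add: S u_def p_def vec_eq_iff forall_3 field_simps)
  finally show "vector [x, y, z] \<in> T" .
qed

text \<open>The last vertex has squared norm \<open>tanh^2 b + tanh^2 c / cosh^2 b\<close>, less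
  than 1 because \<open>tanh c < 1\<close>; convexity of the ball does the rest.\<close>

lemma T_subset: "T \<subseteq> hyp_space"
proof -
  have "norm (vector [0, tanh b, tanh c / cosh b] :: real ^ 3) < 1"
  proof -
    have "(tanh b)\<^sup>2 + (tanh c / cosh b)\<^sup>2 < (tanh b)\<^sup>2 + 1 / (cosh b)\<^sup>2"
      using c tanh_real_lt_1[of c] by (simp add: power_divide divide_strict_right_mono power_less_one_iff)
    also have "\<dots> = 1"
      by (simp add: tanh_def power_divide flip: add_divide_distrib cosh_square_eq)
    finally show ?thesis by (simp add: norm_vec_def L2_set_def sum_3)
  qed
  then show ?thesis
    unfolding T_def hyp_space_def using a b
    by (intro hull_minimal) (auto simp: norm_vec_def L2_set_def sum_3 tanh_real_lt_1)
qed

text \<open>The top \<open>(x, y, k * y)\<close> of the fiber lies in \<open>T\<close>, hence in the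
  unit ball.\<close>

lemma Y_bounds:
  assumes "0 \<le> x" "0 \<le> y" "y \<le> Y x"
  shows "(1 + k\<^sup>2) * y\<^sup>2 < 1 - x\<^sup>2"
proof -
  have "vector [x, y, k * y] \<in> T" using assms k_pos by (simp add: mem_T_iff)
  then have "norm (vector [x, y, k * y] :: real ^ 3) < 1" using T_subset by (auto simp: hyp_space_def)
  then show ?thesis by (simp add: norm_vec_def L2_set_def sum_3 algebra_simps power_mult_distrib)
qed

lemma Y_nonneg_iff: "Y x \<ge> 0 \<longleftrightarrow> x \<le> tanh a"
  using a b by (simp add: Y_def zero_le_mult_iff not_le[symmetric])

section \<open>Iterated integration over fibers and slices\<close>

definition F :: "real \<Rightarrow> real \<Rightarrow> real" where
  "F x y = k * y / (2 * (1 - x\<^sup>2 - y\<^sup>2) * (1 - x\<^sup>2 - y\<^sup>2 - (k * y)\<^sup>2)) +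
     artanh (k * y / sqrt (1 - x\<^sup>2 - y\<^sup>2)) / (2 * (1 - x\<^sup>2 - y\<^sup>2) * sqrt (1 - x\<^sup>2 - y\<^sup>2))"

text \<open>The closed form of the slice integral, from \<open>has_integral_slice\<close> with
  \<open>M = 1 - x^2\<close> and upper limit \<open>Y x\<close>.\<close>

definition H :: "real \<Rightarrow> real" where
  "H x = Y x / sqrt (1 - x\<^sup>2 - (Y x)\<^sup>2) * artanh (k * Y x / sqrt (1 - x\<^sup>2 - (Y x)\<^sup>2)) / (2 * (1 - x\<^sup>2))"

lemma has_integral_F:
  assumes "0 \<le> x" "0 \<le> y" "y \<le> Y x"
  shows "((\<lambda>z. 1 / (1 - x\<^sup>2 - y\<^sup>2 - z\<^sup>2)\<^sup>2) has_integral F x y) {0..k * y}"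
  unfolding F_def using Y_bounds[OF assms] k_pos assms
  by (intro has_integral_fiber) (simp_all add: algebra_simps power_mult_distrib)

lemma F_nonneg: "\<lbrakk>0 \<le> x; 0 \<le> y; y \<le> Y x\<rbrakk> \<Longrightarrow> F x y \<ge> 0"
  using has_integral_F[of x y] by (rule has_integral_nonneg) simp_all

lemma has_integral_H:
  assumes "0 \<le> x" "x \<le> tanh a"
  shows "(F x has_integral H x) {0..Y x}"
proof -
  have Y: "0 \<le> Y x" using assms by (simp add: Y_nonneg_iff)
  have "0 \<le> (1 + k\<^sup>2) * (Y x)\<^sup>2" by simp
  then have "1 - x\<^sup>2 > 0" using Y_bounds[OF assms(1) Y order_refl] by linarith
  then show ?thesis
    unfolding F_def H_def using Y_bounds[OF assms(1) Y order_refl] k_pos Y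
    by (intro has_integral_slice) simp_all
qed

lemma H_nonneg: "\<lbrakk>0 \<le> x; x \<le> tanh a\<rbrakk> \<Longrightarrow> H x \<ge> 0"
  using has_integral_H[of x] F_nonneg[of x] by (auto intro: has_integral_nonneg)

text \<open>\<open>Y_bounds\<close> at the hypotenuse keeps the denominators of \<open>H\<close>
  nonzero and the argument of \<open>artanh\<close> in its domain, as continuity requires.\<close>

lemma H_arg:
  assumes "x \<in> {0..tanh a}"
  shows "1 - x\<^sup>2 > 0" "1 - x\<^sup>2 - (Y x)\<^sup>2 > 0" "\<bar>k * Y x / sqrt (1 - x\<^sup>2 - (Y x)\<^sup>2)\<bar> < 1"
proof -
  have Y: "0 \<le> Y x" using assms by (simp add: Y_nonneg_iff)
  have *: "(1 + k\<^sup>2) * (Y x)\<^sup>2 < 1 - x\<^sup>2" using Y_bounds[of x "Y x"] assms Y by simp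
  have "(1 + k\<^sup>2) * (Y x)\<^sup>2 = (Y x)\<^sup>2 + (k * Y x)\<^sup>2"
    by (simp add: algebra_simps power_mult_distrib)
  moreover have "0 \<le> (Y x)\<^sup>2" "0 \<le> (k * Y x)\<^sup>2" by simp_all
  ultimately show "1 - x\<^sup>2 > 0" "1 - x\<^sup>2 - (Y x)\<^sup>2 > 0" using * by linarith+
  have "sqrt ((k * Y x)\<^sup>2) < sqrt (1 - x\<^sup>2 - (Y x)\<^sup>2)"
    using * by (intro real_sqrt_less_mono) (simp add: algebra_simps power_mult_distrib)
  then show "\<bar>k * Y x / sqrt (1 - x\<^sup>2 - (Y x)\<^sup>2)\<bar> < 1"
    using \<open>1 - x\<^sup>2 - (Y x)\<^sup>2 > 0\<close> by (simp add: abs_divide)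
qed

lemma continuous_on_H: "continuous_on {0..tanh a} H"
proof -
  have [continuous_intros]: "continuous_on A Y" for A
    using a unfolding Y_def [abs_def] by (intro continuous_intros) auto
  have sq: "sqrt (1 - x\<^sup>2 - (Y x)\<^sup>2) \<noteq> 0" if "x \<in> {0..tanh a}" for x
    using H_arg(2)[OF that] by simp
  have "continuous_on {0..tanh a} (\<lambda>x. k * Y x / sqrt (1 - x\<^sup>2 - (Y x)\<^sup>2))"
    using sq by (intro continuous_intros) blast
  moreover have "k * Y x / sqrt (1 - x\<^sup>2 - (Y x)\<^sup>2) \<in> {-1<..<1}" if "x \<in> {0..tanh a}" for x
  proof -
    have "y \<in> {-1<..<1}" if "\<bar>y\<bar> < 1" for y :: real using that by auto
    then show ?thesis using H_arg(3)[OF that] by blast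
  qed
  ultimately have art: "continuous_on {0..tanh a} (\<lambda>x. artanh (k * Y x / sqrt (1 - x\<^sup>2 - (Y x)\<^sup>2)))"
    by (rule continuous_on_artanh')
  have quot: "continuous_on {0..tanh a} (\<lambda>x. Y x / sqrt (1 - x\<^sup>2 - (Y x)\<^sup>2))"
    using sq by (intro continuous_intros) blast
  have den: "continuous_on {0..tanh a} (\<lambda>x. 2 * (1 - x\<^sup>2))" by (intro continuous_intros)
  have nz: "\<forall>x\<in>{0..tanh a}. 2 * (1 - x\<^sup>2) \<noteq> 0"
  proof
    fix x assume "x \<in> {0..tanh a}"
    from H_arg(1)[OF this] show "2 * (1 - x\<^sup>2) \<noteq> 0" by simp
  qed
  show ?thesis
    unfolding H_def [abs_def] by (rule continuous_on_divide[OF continuous_on_mult[OF quot art] den nz])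
qed

text \<open>Tonelli, integrating over \<open>z\<close>, then \<open>y\<close>, then
  \<open>x\<close>; the indicator of \<open>T\<close> factors according to
  \<open>mem_T_iff\<close>.\<close>

lemma volume_T: "measure hyp_volume T = integral {0..tanh a} H"
proof -
  have T: "compact T" "T \<subseteq> hyp_space"
    using T_subset by (simp_all add: T_def finite_imp_compact_convex_hull)
  have [measurable]: "T \<in> sets borel" using T(1) by (simp add: compact_imp_closed)
  have [measurable]: "klein_density \<in> borel_measurable borel"
    unfolding klein_density_def [abs_def] by measurable
  have kd: "klein_density (vector [x, y, z]) = 1 / (1 - x\<^sup>2 - y\<^sup>2 - z\<^sup>2)\<^sup>2" for x y z
    by (simp add: klein_density_def norm_vec_def L2_set_def sum_3 algebra_simps)
  have z: "(\<integral>\<^sup>+z. ennreal (klein_density (vector [x, y, z])) * indicator T (vector [x, y, z]) \<partial>lborel) =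
    ennreal (F x y) * indicator {0..Y x} y * indicator {0..} x" for x y
  proof (cases "0 \<le> x \<and> 0 \<le> y \<and> y \<le> Y x")
    case True
    then have "(\<integral>\<^sup>+z. ennreal (klein_density (vector [x, y, z])) * indicator T (vector [x, y, z]) \<partial>lborel) =
      (\<integral>\<^sup>+z. ennreal (1 / (1 - x\<^sup>2 - y\<^sup>2 - z\<^sup>2)\<^sup>2) * indicator {0..k * y} z \<partial>lborel)"
      by (intro nn_integral_cong) (auto simp: kd indicator_def mem_T_iff)
    also have "\<dots> = ennreal (F x y)"
      using True by (intro nn_integral_has_integral_lebesgue' has_integral_F) auto
    finally show ?thesis using True by simp
  next
    case False
    have "indicator T (vector [x, y, z]) = (0 :: ennreal)" for z
    proof -
      have "0 \<le> y" if "0 \<le> k * y" using that k_pos by (simp add: zero_le_mult_iff)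
      then show ?thesis using False by (auto simp: indicator_def mem_T_iff)
    qed
    then show ?thesis using False by (auto simp: indicator_def)
  qed
  have y: "(\<integral>\<^sup>+y. ennreal (F x y) * indicator {0..Y x} y * indicator {0..} x \<partial>lborel) =
    ennreal (H x) * indicator {0..tanh a} x" for x
  proof (cases "0 \<le> x \<and> x \<le> tanh a")
    case True
    then have "(\<integral>\<^sup>+y. ennreal (F x y) * indicator {0..Y x} y \<partial>lborel) = ennreal (H x)"
      by (intro nn_integral_has_integral_lebesgue' has_integral_H F_nonneg) auto
    then show ?thesis using True by simp
  next
    case False
    \<comment> \<open>For \<open>x > tanh a\<close> the interval \<open>{0..Y x}\<close> is empty;
      for \<open>x < 0\<close> the last indicator vanishes.\<close>
    have "ennreal (F x y) * indicator {0..Y x} y * indicator {0..} x = 0" for y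
      using False Y_nonneg_iff[of x] by (auto simp: indicator_def)
    then have E: "(\<integral>\<^sup>+y. ennreal (F x y) * indicator {0..Y x} y * indicator {0..} x \<partial>lborel) = 0"
      by (simp only: nn_integral_const mult_zero_left)
    show ?thesis unfolding E using False by (auto simp: indicator_def)
  qed
  have I: "(H has_integral integral {0..tanh a} H) {0..tanh a}"
    using continuous_on_H by (intro integrable_integral integrable_continuous_real)
  have "emeasure hyp_volume T = (\<integral>\<^sup>+x. ennreal (H x) * indicator {0..tanh a} x \<partial>lborel)"
    unfolding emeasure_hyp_volume[OF T]
    by (subst nn_integral_real3) (simp_all add: z y)
  also have "\<dots> = ennreal (integral {0..tanh a} H)"
    by (intro nn_integral_has_integral_lebesgue' I) (auto intro: H_nonneg)
  finally show ?thesis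
    using has_integral_nonneg[OF I] H_nonneg by (simp add: measure_def)
qed

text \<open>The hypotenuse \<open>y = Y x\<close> is parametrised by the distance \<open>t\<close> from the axis \<open>A0A1\<close>.\<close>

definition r :: "real \<Rightarrow> real" where "r t = sinh a * tanh t / tanh b"

text \<open>The Klein coordinate of the foot on \<open>A0A1\<close>, where
  \<open>arsinh (r t)\<close> is the distance of the foot from \<open>A0\<close>. As
  \<open>t\<close> runs from \<open>0\<close> to \<open>b\<close>, it moves from \<open>A0\<close>
  to \<open>A1\<close>.\<close>

definition \<xi> :: "real \<Rightarrow> real" where "\<xi> t = tanh (a - arsinh (r t))"

lemma arsinh_r_bounds:
  assumes "t \<in> {0..b}"
  shows "0 \<le> arsinh (r t)" "arsinh (r t) \<le> a"
proof -
  have q: "0 \<le> tanh t / tanh b" "tanh t / tanh b \<le> 1" using assms b by simp_all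
  have s: "0 \<le> sinh a" using a by simp
  have "0 \<le> sinh a * (tanh t / tanh b)" "sinh a * (tanh t / tanh b) \<le> sinh a * 1"
    by (rule mult_nonneg_nonneg[OF s q(1)], rule mult_left_mono[OF q(2) s])
  then have "0 \<le> r t" "r t \<le> sinh a" by (simp_all only: r_def times_divide_eq_right mult_1_right)
  then have "sinh 0 \<le> sinh (arsinh (r t))" "sinh (arsinh (r t)) \<le> sinh a" by simp_all
  then show "0 \<le> arsinh (r t)" "arsinh (r t) \<le> a" by (simp_all only: sinh_real_le_iff)
qed

text \<open>With \<open>s = a - arsinh (r t)\<close>, the subtraction formula turns
  \<open>1 - tanh s / tanh a\<close> into \<open>sinh (a - s) / (sinh a * cosh s)\<close>, whose
  numerator is \<open>r t\<close>.\<close>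

lemma Y_\<xi>: "Y (\<xi> t) = tanh t / cosh (a - arsinh (r t))"
proof -
  define s where "s = a - arsinh (r t)"
  have c: "sinh a > 0" "cosh a > 0" "cosh s > 0" using a by simp_all
  have "1 - tanh s / tanh a = (sinh a * cosh s - cosh a * sinh s) / (sinh a * cosh s)"
    using c by (simp add: tanh_def diff_divide_distrib mult.commute)
  also have "sinh a * cosh s - cosh a * sinh s = sinh (a - s)" by (rule sinh_diff[symmetric])
  also have "sinh (a - s) = r t" by (simp add: s_def)
  finally have "Y (tanh s) = tanh b * (r t / (sinh a * cosh s))" by (simp only: Y_def)
  also have "\<dots> = tanh t / cosh s" using c b by (simp add: r_def)
  finally show ?thesis by (simp only: \<xi>_def s_def)
qed

text \<open>By \<open>Y_\<xi>\<close> the quotient in \<open>H\<close> becomes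
  \<open>sinh t\<close>. The remaining \<open>cosh^2\<close> cancels against the derivative of
  \<open>\<xi>\<close>.\<close>

lemma H_\<xi>:
  "H (\<xi> t) = sinh t * artanh (k * sinh t) * (cosh (a - arsinh (r t)))\<^sup>2 / 2"
proof -
  define s where "s = a - arsinh (r t)"
  have c: "cosh s > 0" "cosh t > 0" by simp_all
  have x: "1 - (\<xi> t)\<^sup>2 = 1 / (cosh s)\<^sup>2" by (simp add: \<xi>_def one_minus_tanh_square flip: s_def)
  have "1 - (\<xi> t)\<^sup>2 - (Y (\<xi> t))\<^sup>2 = (1 - (tanh t)\<^sup>2) / (cosh s)\<^sup>2"
    unfolding x Y_\<xi> s_def[symmetric] by (simp add: power_divide diff_divide_distrib)
  also have "\<dots> = (1 / (cosh t * cosh s))\<^sup>2" by (simp add: one_minus_tanh_square power_divide power_mult_distrib)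
  finally have "sqrt (1 - (\<xi> t)\<^sup>2 - (Y (\<xi> t))\<^sup>2) = 1 / (cosh t * cosh s)"
    using c by simp
  then have q: "Y (\<xi> t) / sqrt (1 - (\<xi> t)\<^sup>2 - (Y (\<xi> t))\<^sup>2) = sinh t"
    using c by (simp add: Y_\<xi> tanh_def flip: s_def)
  have "H (\<xi> t) = (Y (\<xi> t) / sqrt (1 - (\<xi> t)\<^sup>2 - (Y (\<xi> t))\<^sup>2)) *
      artanh (k * (Y (\<xi> t) / sqrt (1 - (\<xi> t)\<^sup>2 - (Y (\<xi> t))\<^sup>2))) / (2 * (1 - (\<xi> t)\<^sup>2))"
    by (simp add: H_def)
  also have "\<dots> = sinh t * artanh (k * sinh t) / (2 * (1 / (cosh s)\<^sup>2))"
    unfolding q unfolding x by simp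
  finally show ?thesis by (simp add: s_def)
qed

lemma has_real_derivative_\<xi>:
  "(\<xi> has_real_derivative - (sinh a / (tanh b * (cosh t)\<^sup>2 * sqrt ((r t)\<^sup>2 + 1)) /
     (cosh (a - arsinh (r t)))\<^sup>2)) (at t within A)"
proof -
  have one: "1 - tanh u * tanh u = 1 / (cosh u)\<^sup>2" for u :: real
    using one_minus_tanh_square[of u] by (simp only: power2_eq_square)
  have "(r has_real_derivative sinh a / (tanh b * (cosh t)\<^sup>2)) (at t within A)"
    unfolding r_def [abs_def] using b
    by (auto intro!: derivative_eq_intros simp: one power2_eq_square[of "tanh _"])
  from DERIV_chain2[OF arsinh_real_has_field_derivative this]
  have "((\<lambda>t. a - arsinh (r t)) has_real_derivative
      - (1 / sqrt ((r t)\<^sup>2 + 1) * (sinh a / (tanh b * (cosh t)\<^sup>2)))) (at t within A)"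
    by (auto intro!: derivative_eq_intros)
  from has_field_derivative_tanh[OF _ this]
  show ?thesis
    unfolding \<xi>_def [abs_def] by (simp add: power2_eq_square[of "tanh _"] one mult_ac)
qed

text \<open>The constant \<open>1 / 4\<close> is the \<open>1 / 2\<close> of \<open>H_\<xi>\<close>
  times the \<open>1 / 2\<close> in \<open>artanh\<close> as a logarithm.\<close>

lemma integrand_eq:
  assumes t: "t \<in> {0..b}"
  shows "- (sinh a / (tanh b * (cosh t)\<^sup>2 * sqrt ((r t)\<^sup>2 + 1)) /
     (cosh (a - arsinh (r t)))\<^sup>2) * H (\<xi> t) =
    - (1 / 4 * (tanh t * sinh a / sqrt ((tanh b)\<^sup>2 * (cosh t)\<^sup>2 + (sinh a)\<^sup>2 * (sinh t)\<^sup>2) *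
      ln ((sinh b + tanh c * sinh t) / (sinh b - tanh c * sinh t))))"
proof -
  define C where "C = cosh (a - arsinh (r t))"
  define R where "R = sqrt ((r t)\<^sup>2 + 1)"
  have C: "C > 0" "R > 0" "tanh b > 0" "cosh t > 0" "sinh b > 0"
    using b by (simp_all add: C_def R_def add_nonneg_pos)
  have "(tanh b)\<^sup>2 * (cosh t)\<^sup>2 + (sinh a)\<^sup>2 * (sinh t)\<^sup>2 = (tanh b * cosh t * R)\<^sup>2"
    using C(3,4) by (simp add: R_def r_def power_mult_distrib power_divide tanh_def[of t] field_simps)
  then have sq: "sqrt ((tanh b)\<^sup>2 * (cosh t)\<^sup>2 + (sinh a)\<^sup>2 * (sinh t)\<^sup>2) = tanh b * cosh t * R"
    using C by simp
  have "artanh (k * sinh t) = ln ((sinh b + tanh c * sinh t) / (sinh b - tanh c * sinh t)) / 2"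
  proof -
    have "1 + k * sinh t = (sinh b + tanh c * sinh t) / sinh b"
      "1 - k * sinh t = (sinh b - tanh c * sinh t) / sinh b"
      using C by (simp_all add: k_def add_divide_distrib diff_divide_distrib)
    then show ?thesis using C by (simp add: artanh_def)
  qed
  then show ?thesis
    unfolding sq H_\<xi> C_def[symmetric] R_def[symmetric] using C
    by (simp add: tanh_def[of t] power2_eq_square field_simps)
qed

lemma volume_T_eq:
  "measure hyp_volume T = 1 / 4 * integral {0..b} (\<lambda>t.
      tanh t * sinh a / sqrt ((tanh b)\<^sup>2 * (cosh t)\<^sup>2 + (sinh a)\<^sup>2 * (sinh t)\<^sup>2) *
      ln ((sinh b + tanh c * sinh t) / (sinh b - tanh c * sinh t)))"
proof -
  let ?f = "\<lambda>t. tanh t * sinh a / sqrt ((tanh b)\<^sup>2 * (cosh t)\<^sup>2 + (sinh a)\<^sup>2 * (sinh t)\<^sup>2) *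
      ln ((sinh b + tanh c * sinh t) / (sinh b - tanh c * sinh t))"
  let ?g' = "\<lambda>t. - (sinh a / (tanh b * (cosh t)\<^sup>2 * sqrt ((r t)\<^sup>2 + 1)) / (cosh (a - arsinh (r t)))\<^sup>2)"
  \<comment> \<open>The substitution reverses orientation: \<open>{\<xi> 0..\<xi> b}\<close> is
    empty because \<open>\<xi> b = 0 < tanh a = \<xi> 0\<close>, and the resulting minus sign
    matches the one in \<open>?g'\<close>.\<close>
  have "((\<lambda>t. ?g' t *\<^sub>R H (\<xi> t)) has_integral
      (integral {\<xi> 0..\<xi> b} H - integral {\<xi> b..\<xi> 0} H)) {0..b}"
  proof (rule has_integral_substitution_general[of "{}"])
    show "\<xi> ` {0..b} \<subseteq> {0..tanh a}" using arsinh_r_bounds by (auto simp: \<xi>_def)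
    show "continuous_on {0..b} \<xi>"
      by (rule DERIV_continuous_on) (rule has_real_derivative_\<xi>)
  qed (use b continuous_on_H has_real_derivative_\<xi> in auto)
  moreover have "\<xi> 0 = tanh a" "\<xi> b = 0"
    using b by (simp_all add: \<xi>_def r_def arsinh_sinh_real)
  ultimately have "((\<lambda>t. ?g' t *\<^sub>R H (\<xi> t)) has_integral - integral {0..tanh a} H) {0..b}"
    using a by simp
  then have "((\<lambda>t. - (1 / 4 * ?f t)) has_integral - integral {0..tanh a} H) {0..b}"
    by (rule has_integral_eq[rotated]) (simp only: real_scaleR_def integrand_eq)
  from has_integral_mult_right[OF has_integral_neg[OF this], of 4]
  have "(?f has_integral 4 * integral {0..tanh a} H) {0..b}" by simp
  then show ?thesis by (simp add: volume_T integral_unique)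
qed

end

theorem theorem1:
  fixes a b c :: real and A0 A1 A2 A3 :: "real ^ 3"
  assumes "a > 0" and "b > 0" and "c > 0"
    and "is_orthoscheme A0 A1 A2 A3 a b c"
  shows "measure hyp_volume (convex hull {A0, A1, A2, A3}) =
    1 / 4 * integral {0..b} (\<lambda>t.
      tanh t * sinh a / sqrt ((tanh b)\<^sup>2 * (cosh t)\<^sup>2 + (sinh a)\<^sup>2 * (sinh t)\<^sup>2) *
      ln ((sinh b + tanh c * sinh t) / (sinh b - tanh c * sinh t)))"
proof -
  interpret canonical_orthoscheme a b c using assms by unfold_locales
  obtain B0 B2 B3 where B: "orthoscheme_vertices B0 0 B2 B3 a b c"
    and vol: "measure hyp_volume (convex hull {A0, A1, A2, A3}) =
      measure hyp_volume (convex hull {B0, 0, B2, B3})"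
    using orthoscheme_at_origin[OF is_orthoscheme_imp_vertices[OF assms(4)]] by blast
  note vol
  also have "measure hyp_volume (convex hull {B0, 0, B2, B3}) = measure hyp_volume T"
    unfolding T_def by (rule orthoscheme_canonical[OF assms(1-3) B])
  finally show ?thesis by (simp only: volume_T_eq)
qed

end
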